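(* Let $(\mathcal{X}, d, T)$ be a topological dynamical system. Then for every $\delta\in (0,1)$, $$\overline{\mathrm{mdim}}_M (\mathcal{X}, d, T)=\limsup_{\epsilon\to 0} \frac{1}{\log \frac{1}{\epsilon}} \sup_{\mu \in \mathcal{E}_T(\mathcal{X})} h_\mu^K (\epsilon, \delta),$$ and $$\underline{\mathrm{mdim}}_M (\mathcal{X}, d, T)=\liminf_{\epsilon\to 0} \frac{1}{\log \frac{1}{\epsilon}} \sup_{\mu \in \mathcal{E}_T(\mathcal{X})} h_\mu^K (\epsilon, \delta).$$
   Context: A topological dynamical system $(\mathcal{X},d,T)$ consists of a compact metric space $(\mathcal{X},d)$ and a homeomorphism $T:\mathcal{X}\to\mathcal{X}$. $\mathcal{E}_T(\mathcal{X})$ denotes the set of ergodic $T$-invariant Borel probability measures on $\mathcal{X}$. For $n\in\mathbb{N}$ set $d_n(x,y)=\max_{0\le k\le n-1} d(T^k x,T^k y)$ and $B_n(x,\epsilon)=\{y\in\mathcal{X}: d_n(x,y)<\epsilon\}$; the sets $B_n(x,\epsilon)$ are called $(n,\epsilon)$-dynamical balls. For $K\subset\mathcal{X}$ and $\epsilon>0$, a set $E\subset K$ is $(n,\epsilon)$-separated if $d_n(x,y)>\epsilon$ for all distinct $x,y\in E$; $s_n(K,\epsilon)$ is the largest cardinality of an $(n,\epsilon)$-separated subset of $K$, and $S(K,\epsilon)=\limsup_{n\to\infty}\frac1n\log s_n(K,\epsilon)$. The upper and lower metric mean dimensions are $$\overline{\mathrm{mdim}}_M(\mathcal{X},d,T)=\limsup_{\epsilon\to0}\frac{S(\mathcal{X},\epsilon)}{\log\frac1\epsilon},\qquad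 \underline{\mathrm{mdim}}_M(\mathcal{X},d,T)=\liminf_{\epsilon\to0}\frac{S(\mathcal{X},\epsilon)}{\log\frac1\epsilon}.$$ For $\delta\in(0,1)$, $n\in\mathbb{N}$ and $\epsilon>0$, $N_\mu^\delta(n,\epsilon)$ is the smallest number of $(n,\epsilon)$-dynamical balls whose union has $\mu$-measure larger than $\delta$. Katok's entropy is $$h_\mu^K(\epsilon,\delta)=\limsup_{n\to\infty}\frac1n\log N_\mu^\delta(n,\epsilon).$$ *)

theory Defs
  imports "HOL-Probability.Probability"
begin

text \<open>
  The compact metric space is the whole of a type of class metric_space, its metric is dist.
  All growth rates are extended reals. The numbers below are meant for \<open>n \<ge> 1\<close>: for
  \<open>n = 0\<close> the maximum in the Bowen metric ranges over the empty set and is unspecified,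
  which does not affect the limits superior as \<open>n \<rightarrow> \<infinity>\<close>.
\<close>

definition bowen_dist :: "('a::metric_space \<Rightarrow> 'a) \<Rightarrow> nat \<Rightarrow> 'a \<Rightarrow> 'a \<Rightarrow> real" where
  "bowen_dist T n x y = Max ((\<lambda>k. dist ((T ^^ k) x) ((T ^^ k) y)) ` {..<n})"

definition dyn_ball :: "('a::metric_space \<Rightarrow> 'a) \<Rightarrow> nat \<Rightarrow> 'a \<Rightarrow> real \<Rightarrow> 'a set" where
  "dyn_ball T n x \<epsilon> = {y. bowen_dist T n x y < \<epsilon>}"

definition dyn_separated :: "('a::metric_space \<Rightarrow> 'a) \<Rightarrow> nat \<Rightarrow> real \<Rightarrow> 'a set \<Rightarrow> bool" where
  "dyn_separated T n \<epsilon> E \<longleftrightarrow> (\<forall>x\<in>E. \<forall>y\<in>E. x \<noteq> y \<longrightarrow> bowen_dist T n x y > \<epsilon>)"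

text \<open>
  The maximum and the minimum in the next two definitions are attained for a homeomorphism of a
  compact space, see \<open>finite_dyn_separated_cards\<close> and \<open>katok_number_attained\<close>
  below; in particular every separated set is then finite.
\<close>

definition sep_number :: "('a::metric_space \<Rightarrow> 'a) \<Rightarrow> 'a set \<Rightarrow> nat \<Rightarrow> real \<Rightarrow> nat" where
  "sep_number T K n \<epsilon> = Max {card E |E. E \<subseteq> K \<and> finite E \<and> dyn_separated T n \<epsilon> E}"

definition katok_number ::
    "('a::metric_space \<Rightarrow> 'a) \<Rightarrow> 'a measure \<Rightarrow> real \<Rightarrow> nat \<Rightarrow> real \<Rightarrow> nat" where
  "katok_number T \<mu> \<delta> n \<epsilon> =
     (LEAST m. \<exists>C. finite C \<and> card C = m \<and> measure \<mu> (\<Union>x\<in>C. dyn_ball T n x \<epsilon>) > \<delta>)"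

definition sep_growth :: "('a::metric_space \<Rightarrow> 'a) \<Rightarrow> 'a set \<Rightarrow> real \<Rightarrow> ereal" where
  "sep_growth T K \<epsilon> = limsup (\<lambda>n. ereal (1 / real n * ln (real (sep_number T K n \<epsilon>))))"

definition katok_entropy ::
    "('a::metric_space \<Rightarrow> 'a) \<Rightarrow> 'a measure \<Rightarrow> real \<Rightarrow> real \<Rightarrow> ereal" where
  "katok_entropy T \<mu> \<epsilon> \<delta> =
     limsup (\<lambda>n. ereal (1 / real n * ln (real (katok_number T \<mu> \<delta> n \<epsilon>))))"

definition upper_mdim :: "('a::metric_space \<Rightarrow> 'a) \<Rightarrow> ereal" where
  "upper_mdim T = Limsup (at_right 0) (\<lambda>\<epsilon>. sep_growth T UNIV \<epsilon> / ereal (ln (1 / \<epsilon>)))"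

definition lower_mdim :: "('a::metric_space \<Rightarrow> 'a) \<Rightarrow> ereal" where
  "lower_mdim T = Liminf (at_right 0) (\<lambda>\<epsilon>. sep_growth T UNIV \<epsilon> / ereal (ln (1 / \<epsilon>)))"

definition ergodic_measures :: "('a::metric_space \<Rightarrow> 'a) \<Rightarrow> 'a measure set" where
  "ergodic_measures T = {\<mu>. sets \<mu> = sets borel \<and> prob_space \<mu> \<and> distr \<mu> borel T = \<mu> \<and>
     (\<forall>A\<in>sets borel. T -` A = A \<longrightarrow> measure \<mu> A = 0 \<or> measure \<mu> A = 1)}"

lemma bowen_dist_less_iff:
  assumes "n > 0"
  shows "bowen_dist T n x y < e \<longleftrightarrow> (\<forall>k<n. dist ((T ^^ k) x) ((T ^^ k) y) < e)"
  unfolding bowen_dist_def using assms by (subst Max_less_iff) auto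

lemma bowen_dist_le_iff:
  assumes "n > 0"
  shows "bowen_dist T n x y \<le> e \<longleftrightarrow> (\<forall>k<n. dist ((T ^^ k) x) ((T ^^ k) y) \<le> e)"
  unfolding bowen_dist_def using assms by (subst Max_le_iff) auto

lemma continuous_on_funpow:
  assumes "continuous_on UNIV (T :: 'a::topological_space \<Rightarrow> 'a)"
  shows "continuous_on UNIV (T ^^ k)"
proof (induction k)
  case (Suc k)
  then show ?case
    using continuous_on_compose[of UNIV "T ^^ k" T] assms continuous_on_subset by (simp, blast)
qed simp

lemma open_dyn_ball:
  assumes "continuous_on UNIV T" "n > 0"
  shows "open (dyn_ball T n x e)"
proof -
  have "dyn_ball T n x e = (\<Inter>k<n. {y. dist ((T ^^ k) x) ((T ^^ k) y) < e})"
    using assms(2) by (auto simp: dyn_ball_def bowen_dist_less_iff)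
  also have "open \<dots>"
    by (intro open_INT ballI open_Collect_less continuous_intros continuous_on_funpow assms) auto
  finally show ?thesis .
qed

lemma finite_dyn_ball_cover:
  fixes T :: "'a::metric_space \<Rightarrow> 'a"
  assumes "compact (UNIV :: 'a set)" "continuous_on UNIV T" "n > 0" "e > 0"
  shows "\<exists>C. finite C \<and> (\<Union>x\<in>C. dyn_ball T n x e) = UNIV"
proof -
  have "x \<in> dyn_ball T n x e" for x
    using assms by (simp add: dyn_ball_def bowen_dist_less_iff)
  then have "UNIV \<subseteq> (\<Union>x\<in>UNIV. dyn_ball T n x e)" by blast
  from compactE_image[OF assms(1) _ this] obtain C where
    "finite C" "UNIV \<subseteq> (\<Union>x\<in>C. dyn_ball T n x e)"
    using open_dyn_ball[OF assms(2,3)] by metis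
  then show ?thesis by blast
qed

lemma dyn_separated_bounded:
  fixes T :: "'a::metric_space \<Rightarrow> 'a"
  assumes "compact (UNIV :: 'a set)" "continuous_on UNIV T" "n > 0" "e > 0"
  shows "\<exists>N. \<forall>E. dyn_separated T n e E \<longrightarrow> finite E \<and> card E \<le> N"
proof -
  obtain C where C: "finite C" "(\<Union>x\<in>C. dyn_ball T n x (e/2)) = UNIV"
    using finite_dyn_ball_cover[OF assms(1-3), of "e/2"] assms(4) by auto
  have "finite E \<and> card E \<le> card C" if E: "dyn_separated T n e E" for E
  proof -
    have "\<forall>y. \<exists>x\<in>C. y \<in> dyn_ball T n x (e/2)" using C(2) by blast
    then obtain f where f: "\<And>y. f y \<in> C" "\<And>y. y \<in> dyn_ball T n (f y) (e/2)" by metis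
    have "inj_on f E"
    proof (rule inj_onI, rule ccontr)
      fix x y assume xy: "x \<in> E" "y \<in> E" "f x = f y" "x \<noteq> y"
      have "dist ((T ^^ k) x) ((T ^^ k) y) \<le> e" if "k < n" for k
      proof -
        have "dist ((T ^^ k) (f x)) ((T ^^ k) x) < e/2" "dist ((T ^^ k) (f x)) ((T ^^ k) y) < e/2"
          using f(2)[of x] f(2)[of y] xy(3) that assms(3)
          unfolding dyn_ball_def mem_Collect_eq bowen_dist_less_iff[OF assms(3)] by auto
        then show ?thesis
          using dist_triangle3[of "(T ^^ k) x" "(T ^^ k) y" "(T ^^ k) (f x)"] by simp
      qed
      then have "bowen_dist T n x y \<le> e" using assms(3) by (simp add: bowen_dist_le_iff)
      then show False using E xy by (force simp: dyn_separated_def)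
    qed
    moreover have "f ` E \<subseteq> C" using f(1) by blast
    ultimately show ?thesis using C(1) by (meson card_inj_on_le inj_on_finite)
  qed
  then show ?thesis by blast
qed

lemma finite_dyn_separated_cards:
  fixes T :: "'a::metric_space \<Rightarrow> 'a"
  assumes "compact (UNIV :: 'a set)" "continuous_on UNIV T" "n > 0" "e > 0"
  shows "finite {card E |E. E \<subseteq> K \<and> finite E \<and> dyn_separated T n e E}"
    and "{card E |E. E \<subseteq> K \<and> finite E \<and> dyn_separated T n e E} \<noteq> {}"
proof -
  obtain N where "\<And>E. dyn_separated T n e E \<Longrightarrow> card E \<le> N"
    using dyn_separated_bounded[OF assms] by blast
  then have "{card E |E. E \<subseteq> K \<and> finite E \<and> dyn_separated T n e E} \<subseteq> {..N}" by auto
  then show "finite {card E |E. E \<subseteq> K \<and> finite E \<and> dyn_separated T n e E}"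
    by (rule finite_subset) simp
  have "dyn_separated T n e {}" by (simp add: dyn_separated_def)
  then show "{card E |E. E \<subseteq> K \<and> finite E \<and> dyn_separated T n e E} \<noteq> {}" by blast
qed

lemma katok_number_attained:
  fixes T :: "'a::metric_space \<Rightarrow> 'a"
  assumes "compact (UNIV :: 'a set)" "continuous_on UNIV T" "n > 0" "e > 0"
    and "prob_space \<mu>" "sets \<mu> = sets borel" "\<delta> < 1"
  shows "\<exists>C. finite C \<and> card C = katok_number T \<mu> \<delta> n e \<and>
           measure \<mu> (\<Union>x\<in>C. dyn_ball T n x e) > \<delta>"
proof -
  obtain C where C: "finite C" "(\<Union>x\<in>C. dyn_ball T n x e) = UNIV"
    using finite_dyn_ball_cover[OF assms(1-4)] by blast
  have "space \<mu> = UNIV" using sets_eq_imp_space_eq[OF assms(6)] by simp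
  then have "measure \<mu> UNIV = 1" using prob_space.prob_space[OF assms(5)] by simp
  then have "\<exists>m C. finite C \<and> card C = m \<and> measure \<mu> (\<Union>x\<in>C. dyn_ball T n x e) > \<delta>"
    using C assms(7) by (intro exI[of _ "card C"] exI[of _ C]) simp
  then show ?thesis unfolding katok_number_def by (rule LeastI_ex)
qed

end

theory Submission
  imports Defs
begin

text \<open>
  The balls of radius \<open>8 \<epsilon>\<close> around a maximal \<open>(n, 4 \<epsilon>)\<close>-separated set cover the space, so Katok's
  entropy at scale \<open>8 \<epsilon>\<close> is at most \<open>S(\<X>, 4 \<epsilon>)\<close>. Conversely, there is an ergodic measure whose
  Katok entropy at scale \<open>\<epsilon>\<close> is at least \<open>S(\<X>, 4 \<epsilon>)\<close>, up to an arbitrarily small error. The constant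
  factors in the scale disappear after dividing by \<open>log (1/\<epsilon>)\<close>.

  The ergodic measure maximises a coding functional. A code of length \<open>n\<close> is a random word of
  points, and \<open>Q x\<close> is its (smoothed) probability of \<open>\<epsilon>\<close>-shadowing the orbit segment of \<open>x\<close>; the
  functional is the infimum of \<open>1/n \<integral> - ln Q d\<mu>\<close> over all \<open>n\<close> and all codes. Since \<open>Q\<close> is continuous,
  it is upper semicontinuous in \<open>\<mu>\<close>. Since the values of \<open>Q\<close> on a separated set add up to at most 1,
  Jensen's inequality bounds it from below for Misiurewicz's empirical measures. Since two codes
  can be mixed at the cost of one bit, it is convex, so that its maximisers form a face
  of the convex set of invariant measures; a maximiser of a strictly convex functional on this
  face is ergodic. For ergodic measures the functional is at most Katok's entropy, because blocks
  which start in a covered set of positive measure can be concatenated to code almost every orbit.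
\<close>

subsection \<open>Codes\<close>

text \<open>The theorem compares quantities at one scale before \<epsilon> tends to 0, so
  inequalities with explicit constants are needed, and the lower bound has to be reached by ergodic
  measures. Two obstacles shape the proof. Entropy with respect to a partition is semicontinuous in
  the measure only if the boundaries of the cells are null. Smoothed probabilities have no
  boundaries, but they blur the shadowing radius from e to 2 e, so two points shadowed by one word
  may be almost 4 e apart: hence the scale 4 e. A maximal separated set covers up to distance at
  most 4 e, whereas balls are defined by a strict inequality: hence a larger radius, 8 e. The second
  obstacle is that the limit of empirical measures is merely invariant. Convexity up to one bit and
  attainment of the maximum lead to an ergodic measure without decomposing that limit. Finally,
  \<delta> is fixed and may be small, so the sets covered by Katok's balls need not fill most of the
  space; ergodicity is used to let all but a small set of orbits reach them within bounded
  time.\<close>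

definition bump :: "real \<Rightarrow> 'a::metric_space \<Rightarrow> 'a \<Rightarrow> real" where
  "bump e z x = max 0 (min 1 (2 - dist z x / e))"

text \<open>A continuous substitute for the indicator of the points whose orbit segment is shadowed
  by the word: it is 1 if all distances are less than e and 0 as soon as one of them reaches 2
  e.\<close>

fun weight :: "('a::metric_space \<Rightarrow> 'a) \<Rightarrow> real \<Rightarrow> 'a list \<Rightarrow> 'a \<Rightarrow> real" where
  "weight T e [] x = 1"
| "weight T e (z # w) x = bump e z x * weight T e w (T x)"

text \<open>Mixtures may be nested, so that products of codes are treated by induction and no flat
  normal form is needed. Coefficients may add up to less than 1, so leftover probability need not be
  assigned. An inductive rule cannot quantify over index types, hence the indices in
  \<open>nat\<close>; \<open>code_mix\<close> lifts the rule to arbitrary finite index sets.\<close>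

inductive code :: "('a::metric_space \<Rightarrow> 'a) \<Rightarrow> real \<Rightarrow> nat \<Rightarrow> ('a \<Rightarrow> real) \<Rightarrow> bool"
  for T e n where
  word: "length w = n \<Longrightarrow> code T e n (weight T e w)"
| mix: "finite I \<Longrightarrow> (\<And>i. i \<in> I \<Longrightarrow> 0 \<le> a i) \<Longrightarrow> (\<Sum>i\<in>I. a i) \<le> 1 \<Longrightarrow>
    (\<And>i. i \<in> I \<Longrightarrow> code T e n (Q i)) \<Longrightarrow> code T e n (\<lambda>x. \<Sum>i\<in>(I::nat set). a i * Q i x)"

lemma bump_bounds: "0 \<le> bump e z x" "bump e z x \<le> 1"
  by (auto simp: bump_def)

lemma bump_eq_1: "e > 0 \<Longrightarrow> dist z x < e \<Longrightarrow> bump e z x = 1"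
  by (simp add: bump_def field_simps)

lemma bump_eq_0: "e > 0 \<Longrightarrow> dist z x \<ge> 2 * e \<Longrightarrow> bump e z x = 0"
  by (simp add: bump_def field_simps)

lemma continuous_on_bump: "e > 0 \<Longrightarrow> continuous_on UNIV (bump e z)"
  unfolding bump_def by (intro continuous_intros) auto

lemma weight_bounds: "0 \<le> weight T e w x" "weight T e w x \<le> 1"
  by (induction w arbitrary: x) (auto intro!: mult_nonneg_nonneg mult_le_one bump_bounds)

lemma weight_append:
  "weight T e (u @ v) x = weight T e u x * weight T e v ((T ^^ length u) x)"
  by (induction u arbitrary: x) (simp_all add: funpow_swap1)

lemma weight_orbit:
  assumes "e > 0" "\<And>k. k < n \<Longrightarrow> dist ((T ^^ k) x) ((T ^^ k) y) < e"
  shows "weight T e (map (\<lambda>k. (T ^^ k) x) [0..<n]) y = 1"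
  using assms(2)
proof (induction n)
  case (Suc n)
  then show ?case using assms(1) by (simp add: weight_append bump_eq_1)
qed simp

lemma weight_pos_imp_close:
  assumes "e > 0" "weight T e w x > 0" "k < length w"
  shows "dist (w ! k) ((T ^^ k) x) < 2 * e"
  using assms(2,3)
proof (induction w arbitrary: x k)
  case (Cons z w)
  have b: "bump e z x > 0" and w: "weight T e w (T x) > 0"
    using Cons.prems(1) bump_bounds(1)[of e z x] weight_bounds(1)[of T e w "T x"]
    by (auto simp: zero_less_mult_iff)
  show ?case
  proof (cases k)
    case 0
    then show ?thesis using b bump_eq_0[OF assms(1), of z x] by (cases "dist z x < 2 * e") auto
  next
    case (Suc j)
    then show ?thesis using Cons.IH[OF w, of j] Cons.prems(2) by (simp add: funpow_swap1)
  qed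
qed simp

lemma code_nonneg: "code T e n Q \<Longrightarrow> 0 \<le> Q x"
  by (induction rule: code.induct) (auto intro!: weight_bounds sum_nonneg)

lemma code_le_1:
  assumes "code T e n Q" shows "Q x \<le> 1"
  using assms
proof (induction rule: code.induct)
  case (mix I a Q)
  have "(\<Sum>i\<in>I. a i * Q i x) \<le> (\<Sum>i\<in>I. a i)"
    using mix by (intro sum_mono) (simp add: mult_left_le)
  then show ?case using mix by simp
qed (rule weight_bounds)

text \<open>The two words are drawn independently and concatenated. The product is linear in each
  factor, so mixtures pass through it and only the case of two words remains.\<close>

lemma code_mult:
  assumes "code T e m P" "code T e n Q"
  shows "code T e (m + n) (\<lambda>x. P x * Q ((T ^^ m) x))"
  using assms(1)
proof (induction rule: code.induct)
  case (word u)
  show ?case using assms(2)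
  proof (induction rule: code.induct)
    case (word v)
    have "(\<lambda>x. weight T e u x * weight T e v ((T ^^ m) x)) = weight T e (u @ v)"
      using \<open>length u = m\<close> by (simp add: weight_append fun_eq_iff)
    then show ?case using word \<open>length u = m\<close> code.word[of "u @ v" "m + n" T e] by simp
  next
    case (mix I a Q)
    have "(\<lambda>x. weight T e u x * (\<Sum>i\<in>I. a i * Q i ((T ^^ m) x))) =
        (\<lambda>x. \<Sum>i\<in>I. a i * (weight T e u x * Q i ((T ^^ m) x)))"
      by (simp add: sum_distrib_left mult_ac)
    then show ?case using mix by (simp add: code.mix)
  qed
next
  case (mix I a P)
  have "(\<lambda>x. (\<Sum>i\<in>I. a i * P i x) * Q ((T ^^ m) x)) =
      (\<lambda>x. \<Sum>i\<in>I. a i * (P i x * Q ((T ^^ m) x)))"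
    by (simp add: sum_distrib_right mult.assoc)
  then show ?case using mix by (simp add: code.mix)
qed

lemma code_mix:
  fixes I :: "'i set"
  assumes "finite I" "\<And>i. i \<in> I \<Longrightarrow> 0 \<le> a i" "(\<Sum>i\<in>I. a i) \<le> 1"
    "\<And>i. i \<in> I \<Longrightarrow> code T e n (Q i)"
  shows "code T e n (\<lambda>x. \<Sum>i\<in>I. a i * Q i x)"
proof -
  obtain f and m :: nat where f: "bij_betw f {..<m} I"
    using ex_bij_betw_nat_finite[OF assms(1)] by (metis atLeast0LessThan)
  have "code T e n (\<lambda>x. \<Sum>i\<in>{..<m}. a (f i) * Q (f i) x)"
    using f assms sum.reindex_bij_betw[OF f, of a]
    by (intro code.mix) (auto simp: bij_betw_apply)
  then show ?thesis by (simp add: sum.reindex_bij_betw[OF f, of "\<lambda>i. a i * Q i _"])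
qed

lemma code_mean:
  assumes "finite I" "I \<noteq> {}" "\<And>i. i \<in> I \<Longrightarrow> code T e n (Q i)"
  shows "code T e n (\<lambda>x. (\<Sum>i\<in>I. Q i x) / card I)"
proof -
  have "code T e n (\<lambda>x. \<Sum>i\<in>I. 1 / card I * Q i x)"
    using assms by (intro code_mix) auto
  then show ?thesis by (simp add: sum_divide_distrib)
qed

text \<open>A single word gives positive weight to at most one point of the separated set: two such
  points stay within 2 e of the same letters, hence less than 4 e from each other. Mixing preserves
  the bound 1.\<close>

lemma code_separated_sum_le:
  assumes "code T e n Q" "e > 0" "n > 0" "finite E" "dyn_separated T n (4 * e) E"
  shows "(\<Sum>x\<in>E. Q x) \<le> 1"
  using assms(1)
proof (induction rule: code.induct)
  case (word w)
  have uniq: "x = y" if "x \<in> E" "y \<in> E" "weight T e w x > 0" "weight T e w y > 0" for x y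
  proof (rule ccontr)
    assume "x \<noteq> y"
    have "dist ((T ^^ k) x) ((T ^^ k) y) < 4 * e" if "k < n" for k
      using weight_pos_imp_close[OF assms(2) \<open>weight T e w x > 0\<close>, of k] word that
        weight_pos_imp_close[OF assms(2) \<open>weight T e w y > 0\<close>, of k]
        dist_triangle3[of "(T ^^ k) x" "(T ^^ k) y" "w ! k"] by simp
    then have "bowen_dist T n x y < 4 * e" using assms(3) by (simp add: bowen_dist_less_iff)
    then show False using assms(5) that(1,2) \<open>x \<noteq> y\<close> by (force simp: dyn_separated_def)
  qed
  have z: "weight T e w x = 0" if "\<not> weight T e w x > 0" for x
    using that weight_bounds(1)[of T e w x] by simp
  show ?case
  proof (cases "\<exists>x\<in>E. weight T e w x > 0")
    case True
    then obtain x where x: "x \<in> E" "weight T e w x > 0" by blast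
    have "(\<Sum>y\<in>E. weight T e w y) = (\<Sum>y\<in>{x}. weight T e w y)"
      using assms(4) x uniq z by (intro sum.mono_neutral_right) auto
    then show ?thesis by (simp add: weight_bounds)
  next
    case False
    then have "(\<Sum>y\<in>E. weight T e w y) = 0" using z by (intro sum.neutral) blast
    then show ?thesis by simp
  qed
next
  case (mix I a Q)
  have "(\<Sum>x\<in>E. \<Sum>i\<in>I. a i * Q i x) = (\<Sum>i\<in>I. a i * (\<Sum>x\<in>E. Q i x))"
    by (subst sum.swap) (simp add: sum_distrib_left)
  also have "\<dots> \<le> (\<Sum>i\<in>I. a i)"
    using mix by (intro sum_mono) (simp add: mult_left_le)
  finally show ?case using mix by simp
qed

lemma continuous_on_weight:
  assumes "continuous_on UNIV T" "e > 0"
  shows "continuous_on UNIV (weight T e w)"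
proof (induction w)
  case (Cons z w)
  have "continuous_on UNIV (\<lambda>x. weight T e w (T x))"
    using continuous_on_compose2[OF Cons assms(1)] by simp
  then have "continuous_on UNIV (\<lambda>x. bump e z x * weight T e w (T x))"
    by (intro continuous_on_mult continuous_on_bump assms)
  then show ?case by simp
qed simp

lemma continuous_on_code:
  assumes "code T e n Q" "continuous_on UNIV T" "e > 0"
  shows "continuous_on UNIV Q"
  using assms(1)
  by (induction rule: code.induct) (auto intro!: continuous_intros continuous_on_weight assms)

section \<open>Uniform codes, powers of codes, and codes made from dynamical balls\<close>

locale compact_system =
  fixes T :: "'a::metric_space \<Rightarrow> 'a" and e :: real
  assumes compact_UNIV: "compact (UNIV :: 'a set)"
    and continuous_T: "continuous_on UNIV T"
    and e_pos: "e > 0"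
begin

lemma code_one: "code T e 0 (\<lambda>_. 1)"
proof -
  have "weight T e [] = (\<lambda>_. 1)" by (simp add: fun_eq_iff)
  then show ?thesis using code.word[of "[]" 0 T e] by simp
qed

text \<open>One letter is drawn uniformly from a finite e-net, and c is the reciprocal of its
  size.\<close>

lemma uniform_code_1:
  obtains U c where "code T e 1 U" "0 < c" "c \<le> 1" "\<And>x. c \<le> U x"
proof -
  obtain Z where Z: "finite Z" "(\<Union>x\<in>Z. dyn_ball T 1 x e) = UNIV"
    using finite_dyn_ball_cover[OF compact_UNIV continuous_T _ e_pos, of 1] by auto
  have ne: "Z \<noteq> {}" using Z by blast
  define U where "U x = (\<Sum>z\<in>Z. weight T e [z] x) / card Z" for x
  have "code T e 1 U" unfolding U_def
    using Z ne by (intro code_mean code.word) auto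
  moreover have "1 / card Z \<le> U x" for x
  proof -
    obtain z where z: "z \<in> Z" "x \<in> dyn_ball T 1 z e" using Z by blast
    then have "dist z x < e" by (simp add: dyn_ball_def bowen_dist_less_iff)
    then have "weight T e [z] x = 1" using e_pos by (simp add: bump_eq_1)
    then have "1 \<le> (\<Sum>z\<in>Z. weight T e [z] x)"
      using member_le_sum[of z Z "\<lambda>z. weight T e [z] x"] z Z by (simp add: weight_bounds del: weight.simps)
    then show ?thesis unfolding U_def using Z ne by (simp add: divide_right_mono)
  qed
  moreover have "0 < 1 / real (card Z)" "1 / real (card Z) \<le> 1"
    using Z ne by (auto simp: Suc_le_eq card_gt_0_iff)
  ultimately show ?thesis using that by blast
qed

text \<open>Filler words: they can describe any orbit segment at a cost of at most
  \<open>- ln c\<close> per letter, and serve to bridge the stretches for which no efficient block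
  is available.\<close>

lemma uniform_codes:
  obtains U c where "\<And>n. code T e n (U n)" "0 < c" "c \<le> 1" "\<And>n x. c ^ n \<le> U n x"
proof -
  obtain V c where V: "code T e 1 V" "0 < c" "c \<le> 1" "\<And>x. c \<le> V x"
    using uniform_code_1 by blast
  have "\<exists>U. code T e n U \<and> (\<forall>x. c ^ n \<le> U x)" for n
  proof (induction n)
    case 0
    then show ?case using code_one by (intro exI[of _ "\<lambda>_. 1"]) auto
  next
    case (Suc n)
    then obtain U where U: "code T e n U" "\<And>x. c ^ n \<le> U x" by blast
    have "code T e (Suc n) (\<lambda>x. V x * U (T x))"
      using code_mult[OF V(1) U(1)] by simp
    moreover have "c ^ Suc n \<le> V x * U (T x)" for x
      using mult_mono[OF V(4)[of x] U(2)[of "T x"]] V(2) order_trans[OF less_imp_le[OF V(2)] V(4)] by simp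
    ultimately show ?case by blast
  qed
  then obtain U where "\<And>n. code T e n (U n)" "\<And>n x. c ^ n \<le> U n x" by metis
  then show ?thesis using that V by blast
qed

lemma code_power:
  assumes "code T e n Q"
  shows "code T e (n * k) (\<lambda>x. \<Prod>j<k. Q ((T ^^ (n * j)) x))"
proof (induction k)
  case 0
  then show ?case using code_one by simp
next
  case (Suc k)
  show ?case using code_mult[OF Suc assms] by (simp add: mult.commute add.commute)
qed

text \<open>A centre is drawn uniformly and its orbit segment is used as the word. Thus few balls
  give a cheap code: on the covered set \<open>- ln (Q x)\<close> is at most
  \<open>ln (card C)\<close>.\<close>

lemma code_dyn_balls:
  assumes "finite C" "C \<noteq> {}" "n > 0"
  obtains Q where "code T e n Q" "\<And>x. x \<in> (\<Union>z\<in>C. dyn_ball T n z e) \<Longrightarrow> 1 / card C \<le> Q x"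
proof -
  define w where "w z = map (\<lambda>k. (T ^^ k) z) [0..<n]" for z
  define Q where "Q x = (\<Sum>z\<in>C. weight T e (w z) x) / card C" for x
  have "code T e n Q" unfolding Q_def
    using assms by (intro code_mean code.word) (auto simp: w_def)
  moreover have "1 / card C \<le> Q x" if x: "x \<in> (\<Union>z\<in>C. dyn_ball T n z e)" for x
  proof -
    obtain z where z: "z \<in> C" "x \<in> dyn_ball T n z e" using x by blast
    then have "weight T e (w z) x = 1"
      using assms(3) e_pos by (simp add: w_def dyn_ball_def bowen_dist_less_iff weight_orbit)
    then have "1 \<le> (\<Sum>z\<in>C. weight T e (w z) x)"
      using member_le_sum[of z C "\<lambda>z. weight T e (w z) x"] z assms by (simp add: weight_bounds)
    then show ?thesis unfolding Q_def using assms by (simp add: divide_right_mono)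
  qed
  ultimately show ?thesis using that by blast
qed

end

subsection \<open>Weak compactness of probability measures on a compact metric space\<close>

definition borel_probs :: "'a::topological_space measure set" where
  "borel_probs = {\<mu>. sets \<mu> = sets borel \<and> prob_space \<mu>}"

definition weakly_converges ::
    "(nat \<Rightarrow> 'a::topological_space measure) \<Rightarrow> 'a measure \<Rightarrow> bool" where
  "weakly_converges \<nu> \<mu> \<longleftrightarrow>
     (\<forall>f::'a \<Rightarrow> real. continuous_on UNIV f \<longrightarrow> (\<lambda>n. \<integral>x. f x \<partial>\<nu> n) \<longlonglongrightarrow> (\<integral>x. f x \<partial>\<mu>))"

lemma borel_probs_space: "\<mu> \<in> borel_probs \<Longrightarrow> space \<mu> = UNIV"
  using sets_eq_imp_space_eq[of \<mu> borel] by (simp add: borel_probs_def)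

lemma continuous_measurable_borel_probs:
  "\<mu> \<in> borel_probs \<Longrightarrow> continuous_on UNIV f \<Longrightarrow> f \<in> borel_measurable \<mu>"
  unfolding borel_probs_def
  using measurable_cong_sets[of \<mu> borel borel borel] borel_measurable_continuous_onI[of f] by blast

lemma compact_UNIV_continuous_bounded:
  fixes f :: "'a::topological_space \<Rightarrow> real"
  assumes "compact (UNIV :: 'a set)" "continuous_on UNIV f"
  obtains B where "B > 0" "\<And>x. \<bar>f x\<bar> \<le> B"
proof -
  have "bounded (range f)" using assms compact_continuous_image compact_imp_bounded by blast
  then obtain B where "B > 0" "\<And>x. \<bar>f x\<bar> \<le> B" by (auto simp: bounded_pos)
  then show ?thesis using that by blast
qed

lemma integrable_continuous_borel_probs:
  fixes f :: "'a::topological_space \<Rightarrow> real"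
  assumes "compact (UNIV :: 'a set)" "\<mu> \<in> borel_probs" "continuous_on UNIV f"
  shows "integrable \<mu> f"
proof -
  obtain B where "\<And>x. \<bar>f x\<bar> \<le> B" using compact_UNIV_continuous_bounded assms by blast
  moreover have "finite_measure \<mu>"
    using assms(2) by (simp add: borel_probs_def prob_space_def)
  ultimately show ?thesis
    using continuous_measurable_borel_probs[OF assms(2,3)]
    by (intro finite_measure.integrable_const_bound[where B=B]) auto
qed

text \<open>The sets are the balls of radius \<open>1 / Suc k\<close> about finite nets, for all k.
  Besides being a base, they locate a point up to any given error through finitely many yes-no
  answers, which is what a coding by digits requires.\<close>

lemma compact_metric_countable_base:
  assumes "compact (UNIV :: 'a::metric_space set)"
  obtains B :: "nat \<Rightarrow> 'a::metric_space set" where "\<And>i. open (B i)"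
    "\<And>e. e > 0 \<Longrightarrow> \<exists>N. \<forall>x y. (\<forall>i<N. x \<in> B i \<longleftrightarrow> y \<in> B i) \<longrightarrow> dist x y < e"
    "\<And>V x. open V \<Longrightarrow> x \<in> V \<Longrightarrow> \<exists>i. x \<in> B i \<and> B i \<subseteq> V"
proof -
  have "\<exists>Z. finite Z \<and> (\<Union>z\<in>Z. ball z (1 / Suc k)) = (UNIV :: 'a set)" for k
    using compactE_image[OF assms, of UNIV "\<lambda>z. ball z (1 / Suc k)"]
    by (metis (no_types, lifting) UNIV_I UN_iff centre_in_ball of_nat_0_less_iff open_ball subsetI
        top.extremum_uniqueI zero_less_Suc zero_less_divide_1_iff)
  then obtain Z :: "nat \<Rightarrow> 'a set" where
    Z: "\<And>k. finite (Z k)" "\<And>k. (\<Union>z\<in>Z k. ball z (1 / Suc k)) = UNIV" by metis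
  define \<B> where "\<B> = (\<Union>k. (\<lambda>z. ball z (1 / Suc k)) ` Z k)"
  define B where "B = from_nat_into \<B>"
  have cnt: "countable \<B>" unfolding \<B>_def by (intro countable_UN[OF countableI_type] countable_image countable_finite Z(1))
  have ne: "\<B> \<noteq> {}" using Z(2)[of 0] by (force simp: \<B>_def)
  have B_in: "B i \<in> \<B>" for i unfolding B_def using ne by (rule from_nat_into)
  have ball: "\<exists>i. B i = ball z (1 / Suc k)" if "z \<in> Z k" for z k
    using from_nat_into_surj[OF cnt, of "ball z (1 / Suc k)"] that by (auto simp: B_def \<B>_def)
  show ?thesis
  proof (rule that[of B])
    show "open (B i)" for i using B_in[of i] by (auto simp: \<B>_def)
    show "\<exists>N. \<forall>x y. (\<forall>i<N. x \<in> B i \<longleftrightarrow> y \<in> B i) \<longrightarrow> dist x y < e" if e: "e > 0" for e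
    proof -
      obtain k where k: "inverse (Suc k) < e / 2" using reals_Archimedean[of "e/2"] e by auto
      obtain \<iota> where \<iota>: "\<And>z. z \<in> Z k \<Longrightarrow> B (\<iota> z) = ball z (1 / Suc k)" using ball[of _ k] by metis
      define N where "N = Suc (Max (\<iota> ` Z k))"
      have "dist x y < e" if xy: "\<forall>i<N. x \<in> B i \<longleftrightarrow> y \<in> B i" for x y
      proof -
        obtain z where z: "z \<in> Z k" "x \<in> ball z (1 / Suc k)" using Z(2)[of k] by blast
        have "\<iota> z < N" unfolding N_def using z Z(1)[of k] by (simp add: le_imp_less_Suc)
        then have "y \<in> ball z (1 / Suc k)" using xy \<iota>[OF z(1)] z(2) by blast
        then show ?thesis using z(2) k dist_triangle3[of x y z] by (simp add: inverse_eq_divide)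
      qed
      then show ?thesis by blast
    qed
    show "\<exists>i. x \<in> B i \<and> B i \<subseteq> V" if V: "open V" "x \<in> V" for V x
    proof -
      obtain e where e: "e > 0" "ball x e \<subseteq> V" using V open_contains_ball by blast
      obtain k where k: "inverse (Suc k) < e / 2" using reals_Archimedean[of "e/2"] e(1) by auto
      obtain z where z: "z \<in> Z k" "x \<in> ball z (1 / Suc k)" using Z(2)[of k] by blast
      have "ball z (1 / Suc k) \<subseteq> ball x e"
      proof
        fix y assume "y \<in> ball z (1 / Suc k)"
        then show "y \<in> ball x e" using z(2) k dist_triangle3[of x y z] by (simp add: inverse_eq_divide)
      qed
      then show ?thesis using ball[OF z(1)] z(2) e by (metis order.trans)
    qed
  qed
qed

text \<open>For \<open>V = UNIV\<close> the distance to the empty complement is 0 by convention.\<close>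

lemma open_indicator_limit:
  fixes V :: "'a::metric_space set"
  assumes "open V"
  shows "(\<lambda>n. min 1 (real n * infdist x (- V))) \<longlonglongrightarrow> (if V = UNIV then 0 else indicator V x)"
proof (cases "V = UNIV")
  case False
  show ?thesis
  proof (cases "x \<in> V")
    case True
    have "infdist x (- V) > 0"
      using in_closed_iff_infdist_zero[of "- V" x] assms False True infdist_nonneg[of x "- V"]
      by (force simp: closed_Compl less_le)
    then obtain m where m: "1 < real m * infdist x (- V)" using reals_Archimedean3 by blast
    have "\<forall>\<^sub>F n in sequentially. min 1 (real n * infdist x (- V)) = 1"
      using eventually_ge_at_top[of m]
    proof eventually_elim
      case (elim n)
      then have "real m * infdist x (- V) \<le> real n * infdist x (- V)"
        by (intro mult_right_mono) (auto simp: infdist_nonneg)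
      then show ?case using m by simp
    qed
    then show ?thesis using False True by (simp add: tendsto_eventually)
  next
    case False
    then have "infdist x (- V) = 0" by simp
    then show ?thesis using False \<open>V \<noteq> UNIV\<close> by simp
  qed
qed (simp add: infdist_def)

text \<open>The indicator of a proper open set is the limit of the Lipschitz functions in
  \<open>eq\<close>, so their integrals determine the measures on the generating \<pi>-system.
  Restricting the hypothesis to these explicit functions keeps the test family countable whenever
  \<open_family> is countable.\<close>

lemma borel_probs_eqI:
  fixes \<mu> \<nu> :: "'a::metric_space measure"
  assumes "\<mu> \<in> borel_probs" "\<nu> \<in> borel_probs" "Int_stable \<G>" "\<And>V. V \<in> \<G> \<Longrightarrow> open V"
    and base: "\<And>V. open V \<Longrightarrow> \<exists>\<B>. countable \<B> \<and> \<B> \<subseteq> \<G> \<and> \<Union>\<B> = V"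
    and eq: "\<And>V n. V \<in> \<G> \<Longrightarrow>
      (\<integral>x. min 1 (real n * infdist x (- V)) \<partial>\<mu>) = (\<integral>x. min 1 (real n * infdist x (- V)) \<partial>\<nu>)"
  shows "\<mu> = \<nu>"
proof -
  have lim: "(\<lambda>n. \<integral>x. min 1 (real n * infdist x (- V)) \<partial>\<xi>) \<longlonglongrightarrow> measure \<xi> V"
    if \<xi>: "\<xi> \<in> borel_probs" and V: "open V" "V \<noteq> UNIV" for \<xi> :: "'a measure" and V
  proof -
    interpret prob_space \<xi> using \<xi> by (simp add: borel_probs_def)
    have s: "sets \<xi> = sets borel" using \<xi> by (simp add: borel_probs_def)
    have "V \<in> sets \<xi>" using V s by simp
    then have "(\<lambda>n. \<integral>x. min 1 (real n * infdist x (- V)) \<partial>\<xi>) \<longlonglongrightarrow> (\<integral>x. indicator V x \<partial>\<xi>)"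
      using V open_indicator_limit[OF V(1)] \<xi>
      by (intro integral_dominated_convergence[where w="\<lambda>_. 1"])
         (auto intro!: continuous_measurable_borel_probs continuous_intros simp: infdist_nonneg)
    then show ?thesis using \<open>V \<in> sets \<xi>\<close> borel_probs_space[OF \<xi>] by simp
  qed
  interpret \<mu>: prob_space \<mu> using assms(1) by (simp add: borel_probs_def)
  interpret \<nu>: prob_space \<nu> using assms(2) by (simp add: borel_probs_def)
  have s: "sets \<mu> = sets borel" "sets \<nu> = sets borel" using assms(1,2) by (auto simp: borel_probs_def)
  have "measure \<mu> V = measure \<nu> V" if V: "V \<in> \<G>" for V
  proof (cases "V = UNIV")
    \<comment> \<open>The distance functions carry no information about the whole space; both total
      masses are 1 instead.\<close>
    case True
    then show ?thesis
      using \<mu>.prob_space \<nu>.prob_space borel_probs_space[OF assms(1)] borel_probs_space[OF assms(2)] by simp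
  next
    case False
    show ?thesis
      using lim[OF assms(1) assms(4)[OF V] False] lim[OF assms(2) assms(4)[OF V] False] eq[OF V]
      by (intro LIMSEQ_unique) auto
  qed
  then have eqm: "emeasure \<mu> V = emeasure \<nu> V" if "V \<in> \<G>" for V
    using that by (simp add: \<mu>.emeasure_eq_measure \<nu>.emeasure_eq_measure)
  have gen: "sets borel = sigma_sets UNIV \<G>"
  proof -
    have "sigma_sets UNIV \<G> = sigma_sets UNIV {S. open S}"
    proof (rule sigma_sets_eqI)
      fix V assume "V \<in> {S::'a set. open S}"
      then obtain \<B> where "countable \<B>" "\<B> \<subseteq> \<G>" "\<Union>\<B> = V" using base by blast
      then show "V \<in> sigma_sets UNIV \<G>" using sigma_sets_UNION[of \<B> UNIV \<G>] by blast
    qed (use assms(4) in auto)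
    then show ?thesis by (simp add: borel_def)
  qed
  obtain \<B> where "countable \<B>" "\<B> \<subseteq> \<G>" "\<Union>\<B> = UNIV" using base[of UNIV] by auto
  then show ?thesis
    using assms(3) eqm gen s
    by (intro measure_eqI_generator_eq_countable[of \<G> UNIV \<mu> \<nu> \<B>]) auto
qed

lemma borel_probs_eqI_continuous:
  fixes \<mu> \<nu> :: "'a::metric_space measure"
  assumes "\<mu> \<in> borel_probs" "\<nu> \<in> borel_probs"
    and "\<And>f::'a \<Rightarrow> real. continuous_on UNIV f \<Longrightarrow> (\<integral>x. f x \<partial>\<mu>) = (\<integral>x. f x \<partial>\<nu>)"
  shows "\<mu> = \<nu>"
proof (rule borel_probs_eqI[OF assms(1,2), of "{V. open V}"])
  show "\<exists>\<B>. countable \<B> \<and> \<B> \<subseteq> {V. open V} \<and> \<Union>\<B> = V" if "open V" for V :: "'a set"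
    using that by (intro exI[of _ "{V}"]) auto
qed (auto simp: Int_stable_def intro!: assms(3) continuous_intros)

text \<open>The finite intersections of a countable base form a countable \<pi>-system. The sequence
  runs through all pairs of such a set and an approximation index; countability is what allows a
  series such as \<open>moment_energy\<close> to be formed.\<close>

lemma separating_sequence:
  assumes "compact (UNIV :: 'a::metric_space set)"
  obtains f :: "nat \<Rightarrow> 'a::metric_space \<Rightarrow> real" where "\<And>k. continuous_on UNIV (f k)" "\<And>k x. \<bar>f k x\<bar> \<le> 1"
    "\<And>\<mu> \<nu>. \<mu> \<in> borel_probs \<Longrightarrow> \<nu> \<in> borel_probs \<Longrightarrow>
      (\<And>k. (\<integral>x. f k x \<partial>\<mu>) = (\<integral>x. f k x \<partial>\<nu>)) \<Longrightarrow> \<mu> = \<nu>"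
proof -
  obtain B :: "nat \<Rightarrow> 'a set" where B: "\<And>i. open (B i)"
    "\<And>V x. open V \<Longrightarrow> x \<in> V \<Longrightarrow> \<exists>i. x \<in> B i \<and> B i \<subseteq> V"
    using compact_metric_countable_base[OF assms] by metis
  define \<G> where "\<G> = {\<Inter>F |F. F \<subseteq> range B \<and> finite F}"
  have cnt: "countable \<G>"
  proof -
    have "\<G> = Inter ` {F. F \<subseteq> range B \<and> finite F}" by (auto simp: \<G>_def)
    moreover have "countable {F. F \<subseteq> range B \<and> finite F}"
      using countable_Collect_finite_subset[of "range B"] by (simp add: conj_commute)
    ultimately show ?thesis by simp
  qed
  have ne: "UNIV \<in> \<G>" unfolding \<G>_def by (auto intro!: exI[of _ "{}"])
  define f :: "nat \<Rightarrow> 'a \<Rightarrow> real" where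
    "f k x = (case prod_decode k of (i, n) \<Rightarrow> min 1 (real n * infdist x (- from_nat_into \<G> i)))" for k x
  show ?thesis
  proof (rule that[of f])
    show "continuous_on UNIV (f k)" for k
      unfolding f_def by (cases "prod_decode k") (auto intro!: continuous_intros)
    show "\<bar>f k x\<bar> \<le> 1" for k x
      unfolding f_def by (cases "prod_decode k") (auto simp: infdist_nonneg)
    fix \<mu> \<nu> :: "'a measure"
    assume *: "\<mu> \<in> borel_probs" "\<nu> \<in> borel_probs" "\<And>k. (\<integral>x. f k x \<partial>\<mu>) = (\<integral>x. f k x \<partial>\<nu>)"
    show "\<mu> = \<nu>"
    proof (rule borel_probs_eqI[OF *(1,2), of \<G>])
      show "Int_stable \<G>"
      proof (rule Int_stableI)
        fix a b assume "a \<in> \<G>" "b \<in> \<G>"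
        then obtain F G where FG: "a = \<Inter>F" "b = \<Inter>G" "F \<subseteq> range B" "finite F" "G \<subseteq> range B" "finite G"
          by (auto simp: \<G>_def)
        then have "a \<inter> b = \<Inter>(F \<union> G)" "F \<union> G \<subseteq> range B" "finite (F \<union> G)" by auto
        then show "a \<inter> b \<in> \<G>" unfolding \<G>_def by blast
      qed
      show "open V" if "V \<in> \<G>" for V
        using that B(1) unfolding \<G>_def by (auto)
      show "\<exists>\<B>. countable \<B> \<and> \<B> \<subseteq> \<G> \<and> \<Union>\<B> = V" if "open V" for V
      proof (intro exI conjI)
        show "countable {B i |i. B i \<subseteq> V}" by (rule countable_subset[of _ "range B"]) auto
        have "B i \<in> \<G>" for i unfolding \<G>_def by (auto intro!: exI[of _ "{B i}"])
        then show "{B i |i. B i \<subseteq> V} \<subseteq> \<G>" by blast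
        show "\<Union>{B i |i. B i \<subseteq> V} = V" using B(2)[OF that] by blast
      qed
      fix V n assume "V \<in> \<G>"
      then obtain i where "from_nat_into \<G> i = V" using from_nat_into_surj[OF cnt] by blast
      then show "(\<integral>x. min 1 (real n * infdist x (- V)) \<partial>\<mu>) = (\<integral>x. min 1 (real n * infdist x (- V)) \<partial>\<nu>)"
        using *(3)[of "prod_encode (i, n)"] by (simp add: f_def)
    qed
  qed
qed

text \<open>The first differing digit changes the sum by \<open>1 / 3 ^ m\<close>, and all later
  digits together by at most half of that. Digits 0 and 1 in base 3 leave this gap; in base 2 the
  later digits could compensate completely.\<close>

lemma ternary_code_gap:
  fixes a b :: "nat \<Rightarrow> real"
  assumes a: "\<And>i. a i \<in> {0, 1}" and b: "\<And>i. b i \<in> {0, 1}"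
    and "\<forall>i<m. a i = b i" "a m \<noteq> b m"
  shows "\<bar>(\<Sum>i. a i / 3 ^ i) - (\<Sum>i. b i / 3 ^ i)\<bar> \<ge> 1 / (2 * 3 ^ m)"
proof -
  have g: "summable (\<lambda>i. 1 / (3::real) ^ i)" using summable_geometric[of "1/3::real"] by (simp add: power_divide)
  have sa: "summable (\<lambda>i. a i / 3 ^ i)" "summable (\<lambda>i. b i / 3 ^ i)"
  proof -
    have "norm (a i / 3 ^ i) \<le> 1 / 3 ^ i" "norm (b i / 3 ^ i) \<le> 1 / 3 ^ i" for i
      using a[of i] b[of i] by auto
    then show "summable (\<lambda>i. a i / 3 ^ i)" "summable (\<lambda>i. b i / 3 ^ i)"
      by (auto intro!: summable_comparison_test'[OF g, of 0])
  qed
  define d where "d i = (a i - b i) / 3 ^ i" for i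
  have d: "\<bar>d i\<bar> \<le> 1 / 3 ^ i" for i
    using a[of i] b[of i] by (auto simp: d_def)
  have sd: "summable d" unfolding d_def diff_divide_distrib using sa by (intro summable_diff)
  have "(\<Sum>i. a i / 3 ^ i) - (\<Sum>i. b i / 3 ^ i) = suminf d"
    unfolding d_def diff_divide_distrib using sa by (rule suminf_diff)
  also have "\<dots> = (\<Sum>i. d (i + Suc m)) + (\<Sum>i<Suc m. d i)"
    by (rule suminf_split_initial_segment[OF sd])
  also have "(\<Sum>i<Suc m. d i) = d m" using assms(3) by (simp add: d_def)
  finally have eq: "(\<Sum>i. a i / 3 ^ i) - (\<Sum>i. b i / 3 ^ i) = (\<Sum>i. d (i + Suc m)) + d m" .
  have geo: "(\<lambda>i. (1 / 3 ^ Suc m) * (1 / 3) ^ i) sums ((1 / 3 ^ Suc m) * (1 / (1 - 1 / 3 :: real)))"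
    by (intro sums_mult geometric_sums) auto
  have "\<bar>\<Sum>i. d (i + Suc m)\<bar> \<le> (1 / 3 ^ Suc m) * (1 / (1 - 1 / 3 :: real))"
    unfolding sums_unique[OF geo] real_norm_def[symmetric]
  proof (rule norm_suminf_le)
    show "norm (d (i + Suc m)) \<le> 1 / 3 ^ Suc m * (1 / 3) ^ i" for i
      using d[of "i + Suc m"] by (simp add: power_add power_divide mult.commute)
  qed (use geo in \<open>simp add: sums_iff\<close>)
  then have "\<bar>\<Sum>i. d (i + Suc m)\<bar> \<le> 1 / (2 * 3 ^ m)" by (simp add: field_simps)
  moreover have "\<bar>d m\<bar> = 1 / 3 ^ m" using assms(4) a[of m] b[of m] by (auto simp: d_def)
  moreover have "1 / 3 ^ m = 2 * (1 / (2 * 3 ^ m) :: real)" by simp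
  ultimately show ?thesis unfolding eq by linarith
qed

text \<open>The i-th ternary digit records membership in the i-th base set. The code is Borel and in
  general not continuous, but by the gap close codes agree on many digits and therefore come from
  close points.\<close>

lemma real_code:
  assumes "compact (UNIV :: 'a::metric_space set)"
  obtains c :: "'a::metric_space \<Rightarrow> real" where "c \<in> borel_measurable borel" "\<And>x. 0 \<le> c x" "\<And>x. c x \<le> 2"
    "\<And>e. e > 0 \<Longrightarrow> \<exists>d>0. \<forall>x y. \<bar>c x - c y\<bar> < d \<longrightarrow> dist x y < e"
proof -
  obtain B :: "nat \<Rightarrow> 'a set" where B: "\<And>i. open (B i)"
    "\<And>e. e > 0 \<Longrightarrow> \<exists>N. \<forall>x y. (\<forall>i<N. x \<in> B i \<longleftrightarrow> y \<in> B i) \<longrightarrow> dist x y < e"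
    using compact_metric_countable_base[OF assms] by metis
  define b :: "'a \<Rightarrow> nat \<Rightarrow> real" where "b x i = indicator (B i) x" for x i
  have b: "b x i \<in> {0, 1}" for x i by (simp add: b_def indicator_def)
  define c where "c x = (\<Sum>i. b x i / 3 ^ i)" for x
  have geo: "(\<lambda>i. (1 / 3 :: real) ^ i) sums (1 / (1 - 1 / 3))" by (intro geometric_sums) auto
  have b_le: "b x i / 3 ^ i \<le> (1 / 3) ^ i" "0 \<le> b x i / 3 ^ i" for x i
    using b[of x i] by (auto simp: power_divide)
  show ?thesis
  proof (rule that[of c])
    show "c \<in> borel_measurable borel"
    proof -
      have [measurable]: "B i \<in> sets borel" for i using B(1) by simp
      show ?thesis unfolding c_def b_def by measurable
    qed
    have sb: "summable (\<lambda>i. b x i / 3 ^ i)" for x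
    proof (rule summable_comparison_test'[of "\<lambda>i. (1/3::real) ^ i" 0])
      show "summable (\<lambda>i. (1/3::real) ^ i)" using geo by (simp only: sums_iff)
      show "norm (b x n / 3 ^ n) \<le> (1/3) ^ n" for n
        using b_le[where x=x and i=n] by (simp only: real_norm_def abs_of_nonneg)
    qed
    show "0 \<le> c x" for x unfolding c_def using b_le(2) sb by (intro suminf_nonneg) auto
    have "c x \<le> (\<Sum>i. (1 / 3 :: real) ^ i)" for x
      unfolding c_def using b_le(1) sb geo by (intro suminf_le) (simp_all only: sums_iff)
    then have "c x \<le> 1 / (1 - 1 / 3)" for x unfolding sums_unique[OF geo, symmetric] .
    then show "c x \<le> 2" for x by (rule order_trans) simp
    show "\<exists>d>0. \<forall>x y. \<bar>c x - c y\<bar> < d \<longrightarrow> dist x y < e" if "e > 0" for e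
    proof -
      obtain N where N: "\<And>x y. (\<forall>i<N. x \<in> B i \<longleftrightarrow> y \<in> B i) \<Longrightarrow> dist x y < e" using B(2)[OF \<open>e > 0\<close>] by blast
      have "dist x y < e" if xy: "\<bar>c x - c y\<bar> < 1 / (2 * 3 ^ N)" for x y
      proof (rule ccontr)
        assume "\<not> dist x y < e"
        then have "\<not> (\<forall>i<N. x \<in> B i \<longleftrightarrow> y \<in> B i)" using N by blast
        then obtain i where "i < N" "x \<in> B i \<longleftrightarrow> y \<notin> B i" by blast
        then have i: "i < N" "b x i \<noteq> b y i" by (auto simp: b_def)
        define m where "m = (LEAST i. b x i \<noteq> b y i)"
        have m: "b x m \<noteq> b y m" "\<forall>i<m. b x i = b y i" "m \<le> i"
          unfolding m_def using LeastI[of "\<lambda>i. b x i \<noteq> b y i" i] i(2)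
          by (auto intro: Least_le dest: not_less_Least)
        have "1 / (2 * 3 ^ m) \<le> \<bar>c x - c y\<bar>"
          unfolding c_def using b m by (intro ternary_code_gap) auto
        moreover have "1 / (2 * 3 ^ N) \<le> 1 / (2 * 3 ^ m :: real)"
          using m(3) i(1) by (intro divide_left_mono) (auto intro!: power_increasing)
        ultimately show False using xy by linarith
      qed
      then show ?thesis by (intro exI[of _ "1 / (2 * 3 ^ N)"]) auto
    qed
  qed
qed

text \<open>The decoding is uniformly continuous on the range of c, so it extends to the closure;
  compactness supplies the limit point. The value at y is characterised by the property that points
  with codes near y lie near it, which yields both continuity and, applied to x itself,
  \<open>g (c x) = x\<close>.\<close>

lemma real_code_decode:
  fixes c :: "'a::metric_space \<Rightarrow> real"
  assumes "compact (UNIV :: 'a set)"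
    and c: "\<And>e. e > 0 \<Longrightarrow> \<exists>d>0. \<forall>x y. \<bar>c x - c y\<bar> < d \<longrightarrow> dist x y < e"
  obtains g where "continuous_on (closure (range c)) g" "\<And>x. g (c x) = x"
proof -
  have "\<exists>x. \<forall>e>0. \<exists>d>0. \<forall>x'. \<bar>c x' - y\<bar> < d \<longrightarrow> dist x' x < e" if y: "y \<in> closure (range c)" for y
  proof -
    obtain u where u: "\<And>n::nat. u n \<in> range c" "u \<longlonglongrightarrow> y" using y unfolding closure_sequential by blast
    have "\<forall>n. \<exists>x. u n = c x" using u(1) by blast
    then obtain v where v: "\<And>n. u n = c (v n)" by metis
    obtain x r where r: "strict_mono r" "(v \<circ> r) \<longlonglongrightarrow> x"
      using compact_imp_seq_compact[OF assms(1)] unfolding seq_compact_def by blast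
    have lim: "(\<lambda>n. c (v (r n))) \<longlonglongrightarrow> y"
      using LIMSEQ_subseq_LIMSEQ[OF u(2) r(1)] v by (simp add: o_def)
    show ?thesis
    proof (rule exI, intro allI impI)
      fix e :: real assume "e > 0"
      then obtain d where d: "d > 0" "\<And>x y. \<bar>c x - c y\<bar> < d \<Longrightarrow> dist x y < e / 2" using c[of "e/2"] by auto
      have "\<forall>\<^sub>F n in sequentially. dist (c (v (r n))) y < d / 2 \<and> dist (v (r n)) x < e / 2"
        using tendstoD[OF lim, of "d/2"] tendstoD[OF r(2), of "e/2"] d(1) \<open>e > 0\<close>
        by (auto intro: eventually_conj simp: o_def)
      then obtain n where n: "dist (c (v (r n))) y < d / 2" "dist (v (r n)) x < e / 2"
        by (auto simp: eventually_sequentially)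
      have "dist x' x < e" if "\<bar>c x' - y\<bar> < d / 2" for x'
      proof -
        have "\<bar>c x' - c (v (r n))\<bar> < d" using n(1) that unfolding dist_real_def by linarith
        then show ?thesis using d(2)[of x' "v (r n)"] n(2) dist_triangle[of x' x "v (r n)"] by simp
      qed
      then show "\<exists>d>0. \<forall>x'. \<bar>c x' - y\<bar> < d \<longrightarrow> dist x' x < e" using d(1) by (intro exI[of _ "d/2"]) auto
    qed
  qed
  then obtain g where g: "\<And>y e. y \<in> closure (range c) \<Longrightarrow> e > 0 \<Longrightarrow>
      \<exists>d>0. \<forall>x'. \<bar>c x' - y\<bar> < d \<longrightarrow> dist x' (g y) < e" by metis
  show ?thesis
  proof (rule that[of g])
    show "g (c x) = x" for x
    proof (rule ccontr)
      assume "g (c x) \<noteq> x"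
      moreover have "c x \<in> closure (range c)" by (rule subsetD[OF closure_subset rangeI])
      ultimately show False using g[of "c x" "dist x (g (c x))"] by (auto dest: spec[of _ x])
    qed
    show "continuous_on (closure (range c)) g"
      unfolding continuous_on_iff
    proof (intro ballI allI impI)
      fix y and e :: real assume y: "y \<in> closure (range c)" "e > 0"
      then obtain d where d: "d > 0" "\<And>x'. \<bar>c x' - y\<bar> < d \<Longrightarrow> dist x' (g y) < e / 2" using g[of y "e/2"] by auto
      have "dist (g z) (g y) < e" if z: "z \<in> closure (range c)" "dist z y < d / 2" for z
      proof -
        obtain d' where d': "d' > 0" "\<And>x'. \<bar>c x' - z\<bar> < d' \<Longrightarrow> dist x' (g z) < e / 2" using g[of z "e/2"] z y by auto
        have "0 < min d' (d / 2)" using d(1) d'(1) by simp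
        then have "\<exists>y\<in>range c. dist y z < min d' (d / 2)"
          using z(1) unfolding closure_approachable by blast
        then obtain x' where x': "dist (c x') z < min d' (d / 2)" by blast
        have "\<bar>c x' - z\<bar> < d'" "\<bar>c x' - y\<bar> < d"
          using x' z(2) unfolding dist_real_def by linarith+
        then show ?thesis using d(2)[of x'] d'(2)[of x'] dist_triangle3[of "g z" "g y" x'] by simp
      qed
      then show "\<exists>d>0. \<forall>x'\<in>closure (range c). dist x' y < d \<longrightarrow> dist (g x') (g y) < e"
        using d(1) by (intro exI[of _ "d/2"]) auto
    qed
  qed
qed

text \<open>
  Helly's theorem on the real line is transferred along the measurable code: its inverse extends
  to a continuous map on the closure of the codes, and the weak limit of the coded measures is
  carried by that closure.
\<close>

lemma borel_probs_seq_compact: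
  fixes \<nu> :: "nat \<Rightarrow> 'a::metric_space measure"
  assumes comp: "compact (UNIV :: 'a set)" and \<nu>: "\<And>n. \<nu> n \<in> borel_probs"
  obtains r \<mu> where "strict_mono r" "\<mu> \<in> borel_probs" "weakly_converges (\<nu> \<circ> r) \<mu>"
proof -
  obtain c :: "'a \<Rightarrow> real" where c: "c \<in> borel_measurable borel" "\<And>x. 0 \<le> c x" "\<And>x. c x \<le> 2"
    "\<And>e. e > 0 \<Longrightarrow> \<exists>d>0. \<forall>x y. \<bar>c x - c y\<bar> < d \<longrightarrow> dist x y < e"
    using real_code[OF comp] by metis
  define K where "K = closure (range c)"
  obtain g where g: "continuous_on K g" "\<And>x. g (c x) = x"
    using real_code_decode[OF comp c(4)] unfolding K_def by metis
  have cK: "c x \<in> K" for x unfolding K_def by (rule subsetD[OF closure_subset rangeI])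
  have s\<nu>: "sets (\<nu> n) = sets borel" for n using \<nu> by (simp add: borel_probs_def)
  have cm: "c \<in> borel_measurable (\<nu> n)" for n using c(1) unfolding measurable_cong_sets[OF s\<nu> refl] .
  define M where "M n = distr (\<nu> n) borel c" for n
  have rd: "real_distribution (M n)" for n
    using \<nu>[of n] cm[of n]
    by (auto simp: M_def real_distribution_def real_distribution_axioms_def borel_probs_def prob_space.prob_space_distr)
  have "tight M"
    unfolding tight_def
  proof (intro conjI allI impI)
    fix \<epsilon> :: real assume "\<epsilon> > 0"
    \<comment> \<open>Tightness is formulated with left-open intervals, so the left end has to lie
      strictly below the smallest possible code 0.\<close>
    have "measure (M n) {- 1<..2} = 1" for n
    proof -
      interpret prob_space "\<nu> n" using \<nu> by (simp add: borel_probs_def)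
      have "c -` {- 1<..2} \<inter> space (\<nu> n) = space (\<nu> n)" using c(2,3) by (force intro: less_le_trans[of _ 0])
      then show ?thesis
        unfolding M_def by (subst measure_distr[OF cm]) (auto simp: prob_space)
    qed
    then show "\<exists>a b. a < b \<and> (\<forall>n. 1 - \<epsilon> < measure (M n) {a<..b})"
    proof (intro exI conjI allI)
      show "(- 1 :: real) < 2" by simp
    qed (use \<open>\<epsilon> > 0\<close> in auto)
  qed (rule rd)
  then obtain r N where r: "strict_mono r" "real_distribution N" "weak_conv_m (M \<circ> r) N"
    using tight_imp_convergent_subsubsequence[of M "\<lambda>n. n"] by (auto simp: strict_mono_def o_def)
  interpret N: real_distribution N by (rule r(2))
  have conv: "(\<lambda>n. \<integral>x. h (c x) \<partial>\<nu> (r n)) \<longlonglongrightarrow> (\<integral>y. h y \<partial>N)"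
    if h: "continuous_on UNIV h" "\<And>y. \<bar>h y\<bar> \<le> B" for h :: "real \<Rightarrow> real" and B
  proof -
    have "(\<lambda>n. \<integral>y. h y \<partial>(M \<circ> r) n) \<longlonglongrightarrow> (\<integral>y. h y \<partial>N)"
      using r(3) h rd r(2)
      by (intro weak_conv_imp_integral_bdd_continuous_conv[where B=B])
         (auto simp: continuous_on_eq_continuous_at o_def)
    moreover have "(\<integral>y. h y \<partial>(M \<circ> r) n) = (\<integral>x. h (c x) \<partial>\<nu> (r n))" for n
      unfolding M_def o_def using borel_measurable_continuous_onI[OF h(1)] by (intro integral_distr cm)
    ultimately show ?thesis by simp
  qed
  have "closed K" unfolding K_def by simp
  have K_ne: "K \<noteq> {}" using cK by blast
  \<comment> \<open>A bounded continuous function whose zero set is exactly the closed set K. Its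
    integral is 0 for every coded measure, hence also for the limit, which is thus carried by
    K.\<close>
  define h where "h y = min 1 (infdist y K)" for y
  have h_cont: "continuous_on UNIV h" unfolding h_def by (intro continuous_intros)
  have hb: "\<bar>h y\<bar> \<le> 1" for y by (simp add: h_def infdist_nonneg)
  have "(\<integral>y. h y \<partial>N) = 0"
    using conv[OF h_cont hb] cK by (simp add: h_def LIMSEQ_const_iff)
  moreover have "integrable N h"
    using hb borel_measurable_continuous_onI[OF h_cont]
    by (intro N.integrable_const_bound[where B=1]) auto
  ultimately have "AE y in N. h y = 0"
    by (subst (asm) integral_nonneg_eq_0_iff_AE) (auto simp: h_def infdist_nonneg)
  then have AE_K: "AE y in N. y \<in> K"
  proof eventually_elim
    case (elim y)
    then have "infdist y K = 0" by (simp add: h_def min_def split: if_splits)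
    then show ?case using in_closed_iff_infdist_zero[OF \<open>closed K\<close> K_ne] by simp
  qed
  define G where "G y = (if y \<in> K then g y else undefined)" for y
  have Gm: "G \<in> borel_measurable borel"
    unfolding G_def using \<open>closed K\<close> g(1) by (intro borel_measurable_continuous_on_if) auto
  then have Gm': "G \<in> measurable N borel" by simp
  define \<mu> where "\<mu> = distr N borel G"
  show ?thesis
  proof (rule that[OF r(1), of \<mu>])
    show "\<mu> \<in> borel_probs"
      unfolding \<mu>_def borel_probs_def using N.prob_space_distr[OF Gm'] by simp
    show "weakly_converges (\<nu> \<circ> r) \<mu>"
      unfolding weakly_converges_def
    proof (intro allI impI)
      fix f :: "'a \<Rightarrow> real" assume f: "continuous_on UNIV f"
      obtain B where B: "B > 0" "\<And>x. \<bar>f x\<bar> \<le> B" using compact_UNIV_continuous_bounded[OF comp f] by metis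
      have "continuous_on K (\<lambda>y. f (g y))" using continuous_on_compose2[OF f g(1)] by simp
      \<comment> \<open>Weak convergence on the line tests functions on the whole line, so the
        decoded function is extended from K by Tietze's theorem with the same bound.\<close>
      then obtain k where k: "continuous_on UNIV k" "\<And>y. y \<in> K \<Longrightarrow> k y = f (g y)" "\<And>y. \<bar>k y\<bar> \<le> B"
        using Tietze[of K "\<lambda>y. f (g y)" UNIV B] \<open>closed K\<close> B by auto
      have "(\<integral>x. f x \<partial>\<mu>) = (\<integral>y. f (G y) \<partial>N)"
        unfolding \<mu>_def using borel_measurable_continuous_onI[OF f] by (intro integral_distr Gm')
      also have "\<dots> = (\<integral>y. k y \<partial>N)"
      proof (rule integral_cong_AE)
        show "(\<lambda>y. f (G y)) \<in> borel_measurable N"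
          using measurable_compose[OF Gm' borel_measurable_continuous_onI[OF f]] .
        show "AE y in N. f (G y) = k y" using AE_K by eventually_elim (simp add: G_def k(2))
      qed (use borel_measurable_continuous_onI[OF k(1)] in simp)
      finally show "(\<lambda>n. \<integral>x. f x \<partial>(\<nu> \<circ> r) n) \<longlonglongrightarrow> (\<integral>x. f x \<partial>\<mu>)"
        using conv[OF k(1,3)] cK by (simp add: k(2) g(2))
    qed
  qed
qed

subsection \<open>Code entropy of ergodic measures\<close>

definition invariant_probs :: "('a::topological_space \<Rightarrow> 'a) \<Rightarrow> 'a measure set" where
  "invariant_probs T = {\<mu> \<in> borel_probs. distr \<mu> borel T = \<mu>}"

text \<open>A lower bound on the infimum, expressed without forming it, so that each code
  contributes one inequality that can be passed to a weak limit. Positivity of Q keeps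
  \<open>- ln (Q x)\<close> continuous; a zero of Q should cost infinitely much, but
  \<open>ln 0 = 0\<close> would make it free.\<close>

definition code_entropy_ge :: "('a::metric_space \<Rightarrow> 'a) \<Rightarrow> real \<Rightarrow> 'a measure \<Rightarrow> real \<Rightarrow> bool" where
  "code_entropy_ge T e \<mu> h \<longleftrightarrow>
     (\<forall>n Q. n > 0 \<longrightarrow> code T e n Q \<longrightarrow> (\<forall>x. Q x > 0) \<longrightarrow> real n * h \<le> (\<integral>x. - ln (Q x) \<partial>\<mu>))"

lemma continuous_on_neg_ln:
  assumes "continuous_on UNIV Q" "\<And>x. Q x > (0::real)"
  shows "continuous_on UNIV (\<lambda>x. - ln (Q x))"
  using assms by (intro continuous_intros) (auto simp: less_imp_neq[THEN not_sym])

context compact_system begin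

lemma measurable_funpow: "T ^^ k \<in> measurable borel borel"
  by (intro borel_measurable_continuous_onI continuous_on_funpow continuous_T)

lemma invariant_distr_funpow:
  assumes "\<mu> \<in> invariant_probs T"
  shows "distr \<mu> borel (T ^^ k) = \<mu>"
proof (induction k)
  case 0
  have "sets \<mu> = sets borel" using assms by (simp add: invariant_probs_def borel_probs_def)
  then show ?case using distr_id2[of borel \<mu>] by (simp add: id_def)
next
  case (Suc k)
  have s: "sets \<mu> = sets borel" using assms by (simp add: invariant_probs_def borel_probs_def)
  have m: "T ^^ k \<in> measurable \<mu> borel"
    using measurable_funpow[of k] unfolding measurable_cong_sets[OF s refl, of borel] .
  have mT: "T \<in> measurable borel borel" using measurable_funpow[of 1] by simp
  have "distr \<mu> borel (T ^^ Suc k) = distr (distr \<mu> borel (T ^^ k)) borel T"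
    by (simp add: distr_distr[OF mT m])
  also have "\<dots> = distr \<mu> borel T" by (simp only: Suc)
  also have "\<dots> = \<mu>" using assms by (simp add: invariant_probs_def)
  finally show ?case .
qed

lemma invariant_integral_funpow:
  fixes f :: "'a \<Rightarrow> real"
  assumes "\<mu> \<in> invariant_probs T" "f \<in> borel_measurable borel"
  shows "(\<integral>x. f ((T ^^ k) x) \<partial>\<mu>) = (\<integral>x. f x \<partial>\<mu>)"
proof -
  have s: "sets \<mu> = sets borel" using assms by (simp add: invariant_probs_def borel_probs_def)
  have m: "T ^^ k \<in> measurable \<mu> borel"
    using measurable_funpow[of k] unfolding measurable_cong_sets[OF s refl, of borel] .
  have "(\<integral>x. f x \<partial>distr \<mu> borel (T ^^ k)) = (\<integral>x. f ((T ^^ k) x) \<partial>\<mu>)"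
    by (rule integral_distr[OF m assms(2)])
  then show ?thesis by (simp add: invariant_distr_funpow[OF assms(1)])
qed

lemma invariant_measure_funpow:
  assumes "\<mu> \<in> invariant_probs T" "A \<in> sets borel"
  shows "measure \<mu> ((T ^^ k) -` A) = measure \<mu> A" "(T ^^ k) -` A \<in> sets borel"
proof -
  have s: "sets \<mu> = sets borel" using assms by (simp add: invariant_probs_def borel_probs_def)
  have m: "T ^^ k \<in> measurable \<mu> borel"
    using measurable_funpow[of k] unfolding measurable_cong_sets[OF s refl, of borel] .
  show "measure \<mu> ((T ^^ k) -` A) = measure \<mu> A"
    using measure_distr[OF m assms(2)] invariant_distr_funpow[OF assms(1), of k]
      borel_probs_space[of \<mu>] assms(1) by (simp add: invariant_probs_def)
  show "(T ^^ k) -` A \<in> sets borel"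
    using measurable_sets[OF measurable_funpow assms(2), of k] by simp
qed

lemma ergodic_measures_invariant: "\<mu> \<in> ergodic_measures T \<Longrightarrow> \<mu> \<in> invariant_probs T"
  by (auto simp: ergodic_measures_def invariant_probs_def borel_probs_def)

text \<open>Almost every orbit visits a set of positive measure; continuity of the measure from
  below turns this into a uniform waiting time J outside a set of measure less than \<eta>.\<close>

lemma ergodic_hitting:
  assumes \<mu>: "\<mu> \<in> ergodic_measures T" and B: "B \<in> sets borel" "measure \<mu> B > 0" and "\<eta> > 0"
  obtains J :: nat where "J > 0" "measure \<mu> (\<Union>j<J. (T ^^ j) -` B) > 1 - \<eta>"
proof -
  note inv = ergodic_measures_invariant[OF \<mu>]
  interpret prob_space \<mu> using \<mu> by (simp add: ergodic_measures_def)
  have s: "sets \<mu> = sets borel" using \<mu> by (simp add: ergodic_measures_def)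
  have TB: "(T ^^ j) -` B \<in> sets borel" for j using invariant_measure_funpow(2)[OF inv B(1)] .
  define D where "D k = (\<Union>j\<in>{k..}. (T ^^ j) -` B)" for k
  have D_sets: "D k \<in> sets borel" for k unfolding D_def using TB by auto
  have D_shift: "D k = (T ^^ k) -` D 0" for k
  proof -
    have "x \<in> D k \<longleftrightarrow> x \<in> (T ^^ k) -` D 0" for x
    proof -
      have "x \<in> D k \<longleftrightarrow> (\<exists>i. (T ^^ (i + k)) x \<in> B)"
        unfolding D_def by (auto simp: le_iff_add add.commute)
      also have "\<dots> \<longleftrightarrow> x \<in> (T ^^ k) -` D 0" by (auto simp: D_def funpow_add)
      finally show ?thesis .
    qed
    then show ?thesis by blast
  qed
  \<comment> \<open>Ergodicity is stated for sets equal to their preimage. The preimage of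
    \<open>D 0\<close> is only contained in \<open>D 0\<close>, so the set of points with infinitely
    many visits to B is used; it has the same measure, since all \<open>D k\<close> have equal
    measure.\<close>
  define A where "A = (\<Inter>k. D k)"
  have dec: "decseq D" unfolding D_def decseq_def by (intro allI impI UN_mono) auto
  have "T -` A = A"
  proof -
    have "T -` D k = D (Suc k)" for k
      unfolding D_shift[of k] D_shift[of "Suc k"] by (auto simp: funpow_swap1)
    then have "T -` A = (\<Inter>k. D (Suc k))" by (simp add: A_def vimage_INT)
    moreover have "D (Suc k) \<subseteq> D k" for k using dec by (simp add: decseq_Suc_iff)
    then have "x \<in> D (Suc k) \<Longrightarrow> x \<in> D k" for x k by (rule subsetD)
    then have "(\<Inter>k. D (Suc k)) = A" by (auto simp: A_def)
    ultimately show ?thesis by simp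
  qed
  moreover have "A \<in> sets borel" unfolding A_def using D_sets by auto
  ultimately have A01: "measure \<mu> A = 0 \<or> measure \<mu> A = 1" using \<mu> by (simp add: ergodic_measures_def)
  have mD: "measure \<mu> (D k) = measure \<mu> (D 0)" for k
    unfolding D_shift[of k] by (rule invariant_measure_funpow(1)[OF inv D_sets])
  have "(\<lambda>k. measure \<mu> (D k)) \<longlonglongrightarrow> measure \<mu> A"
    unfolding A_def using dec D_sets s by (intro finite_Lim_measure_decseq) auto
  moreover have "(\<lambda>k. measure \<mu> (D k)) = (\<lambda>_. measure \<mu> (D 0))" by (rule ext) (rule mD)
  ultimately have "measure \<mu> A = measure \<mu> (D 0)" by (simp add: LIMSEQ_const_iff)
  moreover have "B \<subseteq> D 0" by (auto simp: D_def intro!: exI[of _ 0])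
  then have "measure \<mu> B \<le> measure \<mu> (D 0)"
    using D_sets[of 0] s by (intro finite_measure_mono) auto
  ultimately have D1: "measure \<mu> (D 0) = 1" using A01 B(2) by simp
  have "(\<lambda>J. measure \<mu> (\<Union>j<J. (T ^^ j) -` B)) \<longlonglongrightarrow> measure \<mu> (\<Union>J. \<Union>j<J. (T ^^ j) -` B)"
  proof (rule finite_Lim_measure_incseq)
    show "incseq (\<lambda>J. \<Union>j<J. (T ^^ j) -` B)" unfolding incseq_def by (intro allI impI UN_mono) auto
  qed (use TB s in auto)
  moreover have "(\<Union>J. \<Union>j<J. (T ^^ j) -` B) = D 0" by (auto simp: D_def)
  ultimately have "(\<lambda>J. measure \<mu> (\<Union>j<J. (T ^^ j) -` B)) \<longlonglongrightarrow> 1" using D1 by simp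
  then have "\<forall>\<^sub>F J in sequentially. measure \<mu> (\<Union>j<J. (T ^^ j) -` B) > 1 - \<eta>"
    using \<open>\<eta> > 0\<close> by (intro order_tendstoD) auto
  then have "\<forall>\<^sub>F J in sequentially. J > 0 \<and> measure \<mu> (\<Union>j<J. (T ^^ j) -` B) > 1 - \<eta>"
    using eventually_gt_at_top[of 0] by eventually_elim simp
  then obtain J where "J > 0" "measure \<mu> (\<Union>j<J. (T ^^ j) -` B) > 1 - \<eta>"
    by (auto simp: eventually_sequentially)
  then show ?thesis using that by blast
qed

text \<open>
  Codes of long blocks are built greedily: with probability one half the next letter is spelled
  out, otherwise a block of a random length n between m and l is drawn from the n-th given code.
\<close>

lemma concatenated_code:
  assumes U: "code T e 1 U" "0 < c" "c \<le> 1" "\<And>x. c \<le> U x"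
    and Q: "\<And>n. m \<le> n \<Longrightarrow> code T e n (Q n)"
    and QA: "\<And>n x. m \<le> n \<Longrightarrow> x \<in> A n \<Longrightarrow> exp (- (real n * h)) \<le> Q n x"
    and "0 < m" "0 \<le> h" "0 \<le> \<eta>"
    and tail: "(\<Sum>n = m..l. exp (- \<eta>) ^ n) \<le> 1 / 2"
  shows "\<exists>R. code T e N R \<and> (\<forall>x. exp (- (real N * (h + \<eta>) +
           ln (2 / c) * (\<Sum>i<N. indicator (- (\<Union>n\<in>{m..l}. A n)) ((T ^^ i) x)) + ln (2 / c) * real l)) \<le> R x)"
proof (induction N rule: less_induct)
  case (less N)
  define K where "K = ln (2 / c)"
  have c2: "c / 2 = exp (- K)" using U(2) by (simp add: K_def exp_minus exp_ln)
  have K: "K \<ge> 0" using U(2,3) by (simp add: K_def)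
  define G where "G = (\<Union>n\<in>{m..l}. A n)"
  define V where "V N x = (\<Sum>i<N. indicator (- G) ((T ^^ i) x) :: real)" for N x
  have V_nonneg: "V N x \<ge> 0" for N x by (simp add: V_def sum_nonneg)
  \<comment> \<open>Each letter is charged h for the content of blocks and \<eta> for announcing
    their lengths. Each time spent outside G costs K in addition, and \<open>K * real l\<close> pays
    once for the final stretch.\<close>
  define b where "b N x = real N * (h + \<eta>) + K * V N x + K * real l" for N x
  have V_add: "V (n + k) x = V n x + V k ((T ^^ n) x)" for n k x
  proof -
    have "V (n + k) x = V n x + (\<Sum>i<k. indicator (- G) ((T ^^ (n + i)) x))"
      unfolding V_def by (induction k) auto
    then show ?thesis by (simp add: V_def funpow_add funpow_swap1 add.commute[of n])
  qed
  have goal: "\<exists>R. code T e N R \<and> (\<forall>x. exp (- b N x) \<le> R x)"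
  proof (cases "N \<le> l")
    \<comment> \<open>With at most l letters left a block may no longer fit. All of them are spelled
      out, at a cost of at most K each, which \<open>K * real l\<close> covers.\<close>
    case True
    have "code T e (1 * N) (\<lambda>x. \<Prod>j<N. U ((T ^^ (1 * j)) x))" by (rule code_power[OF U(1)])
    moreover have "exp (- b N x) \<le> (\<Prod>j<N. U ((T ^^ (1 * j)) x))" for x
    proof -
      have "K * real N \<le> b N x"
        using True K V_nonneg[of N x] \<open>0 \<le> h\<close> \<open>0 \<le> \<eta>\<close> mult_left_mono[of "real N" "real l" K]
        unfolding b_def by (intro add_increasing) (auto intro!: mult_nonneg_nonneg add_nonneg_nonneg)
      then have "exp (- b N x) \<le> exp (real N * (- K))" by (simp add: mult.commute)
      also have "\<dots> = (c / 2) ^ N" unfolding exp_of_nat_mult c2 ..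
      also have "\<dots> \<le> (\<Prod>j<N. U ((T ^^ (1 * j)) x))"
      proof -
        have "c / 2 \<le> U y" for y using U(2) U(4)[of y] by linarith
        then have "(\<Prod>j<N. c / 2) \<le> (\<Prod>j<N. U ((T ^^ (1 * j)) x))"
          using U(2) by (intro prod_mono) auto
        then show ?thesis by simp
      qed
      finally show ?thesis .
    qed
    ultimately show ?thesis by (intro exI[of _ "\<lambda>x. \<Prod>j<N. U ((T ^^ (1 * j)) x)"]) simp
  next
    case False
    then have "\<forall>k. \<exists>R. k < N \<longrightarrow> code T e k R \<and> (\<forall>x. exp (- b k x) \<le> R x)"
      using less.IH unfolding b_def V_def G_def K_def by blast
    then obtain R where R: "\<And>k. k < N \<Longrightarrow> code T e k (R k)" "\<And>k x. k < N \<Longrightarrow> exp (- b k x) \<le> R k x"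
      by metis
    define P where "P n = (if n = 0 then (\<lambda>x. U x * R (N - 1) ((T ^^ 1) x)) else (\<lambda>x. Q n x * R (N - n) ((T ^^ n) x)))" for n
    \<comment> \<open>Index 0 stands for spelling out one letter and cannot be a block length
      because \<open>0 < m\<close>. A block of length n has weight
      \<open>exp (- \<eta>) ^ n\<close>, so by \<open>tail\<close> the blocks together use at most
      the other half of the probability.\<close>
    define a where "a n = (if n = 0 then 1 / 2 else exp (- \<eta>) ^ n)" for n :: nat
    define I where "I = insert 0 {m..l}"
    have I: "finite I" by (simp add: I_def)
    have P: "code T e N (P n)" if "n \<in> I" for n
    proof (cases "n = 0")
      case True
      then show ?thesis using code_mult[OF U(1) R(1)[of "N - 1"]] False by (simp add: P_def)
    next
      case nz: False
      then have "m \<le> n" "n \<le> l" using that by (auto simp: I_def)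
      then show ?thesis using code_mult[OF Q R(1), of n "N - n"] nz False by (simp add: P_def)
    qed
    have "code T e N (\<lambda>x. \<Sum>n\<in>I. a n * P n x)"
    proof (rule code_mix[OF I _ _ P])
      have "(\<Sum>n\<in>I. a n) = 1 / 2 + (\<Sum>n = m..l. a n)"
        using \<open>0 < m\<close> by (simp add: I_def a_def)
      also have "(\<Sum>n = m..l. a n) = (\<Sum>n = m..l. exp (- \<eta>) ^ n)"
        using \<open>0 < m\<close> by (intro sum.cong) (auto simp: a_def)
      finally show "(\<Sum>n\<in>I. a n) \<le> 1" using tail by simp
    qed (auto simp: a_def)
    moreover have "exp (- b N x) \<le> (\<Sum>n\<in>I. a n * P n x)" for x
    proof -
      have "\<exists>n\<in>I. exp (- b N x) \<le> a n * P n x"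
      proof (cases "x \<in> G")
        case True
        then obtain n where n: "m \<le> n" "n \<le> l" "x \<in> A n" by (auto simp: G_def)
        then have "n > 0" "n < N" "n \<in> I" using \<open>0 < m\<close> False by (auto simp: I_def)
        \<comment> \<open>Times outside G that fall inside the block are skipped and not
          charged.\<close>
        have "V (N - n) ((T ^^ n) x) \<le> V N x"
          using V_add[of n "N - n" x] V_nonneg[of n x] \<open>n < N\<close> by simp
        then have "K * V (N - n) ((T ^^ n) x) \<le> K * V N x" using K by (rule mult_left_mono)
        then have "n * \<eta> + n * h + b (N - n) ((T ^^ n) x) \<le> b N x"
          using \<open>n < N\<close> by (simp add: b_def of_nat_diff algebra_simps)
        then have "exp (- b N x) \<le> exp (n * (- \<eta>)) * (exp (- (n * h)) * exp (- b (N - n) ((T ^^ n) x)))"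
          by (simp flip: exp_add)
        also have "\<dots> \<le> exp (n * (- \<eta>)) * (Q n x * R (N - n) ((T ^^ n) x))"
          using QA[OF n(1,3)] R(2)[of "N - n" "(T ^^ n) x"] \<open>n > 0\<close> \<open>n < N\<close>
          by (intro mult_left_mono mult_mono) (auto intro: order_trans[OF less_imp_le[OF exp_gt_zero]])
        also have "exp (n * (- \<eta>)) = a n" unfolding exp_of_nat_mult a_def using \<open>n > 0\<close> by simp
        finally show ?thesis using \<open>n \<in> I\<close> \<open>n > 0\<close> by (intro bexI[of _ n]) (simp_all add: P_def)
      next
        case nG: False
        have "V N x = 1 + V (N - 1) ((T ^^ 1) x)"
          using V_add[of 1 "N - 1" x] nG False by (simp add: V_def)
        then have "K + b (N - 1) ((T ^^ 1) x) \<le> b N x"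
          using False \<open>0 \<le> h\<close> \<open>0 \<le> \<eta>\<close> by (simp add: b_def of_nat_diff algebra_simps)
        then have "exp (- b N x) \<le> exp (- K) * exp (- b (N - 1) ((T ^^ 1) x))"
          by (simp flip: exp_add)
        also have "\<dots> \<le> (U x / 2) * R (N - 1) ((T ^^ 1) x)"
          using R(2)[of "N - 1" "(T ^^ 1) x"] False U(2) U(4)[of x] unfolding c2[symmetric]
          by (intro mult_mono) auto
        finally show ?thesis by (intro bexI[of _ 0]) (simp_all add: P_def a_def I_def)
      qed
      then obtain n where n: "n \<in> I" "exp (- b N x) \<le> a n * P n x" by blast
      have "a n * P n x \<le> (\<Sum>n\<in>I. a n * P n x)"
        using I n(1) code_nonneg[OF P] by (intro member_le_sum) (auto simp: a_def)
      then show ?thesis using n(2) by linarith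
    qed
    ultimately show ?thesis by blast
  qed
  then show ?case unfolding b_def V_def G_def K_def .
qed

text \<open>The exponent of the concatenated code is integrated. By invariance the expected number
  of times outside G is at most \<open>N * \<eta>\<close>, so the cost per letter is at most
  \<open>h + \<eta> + K * \<eta> + K * l / N\<close>, and the last term vanishes as N grows.\<close>

lemma code_entropy_le_of_covering:
  assumes \<mu>: "\<mu> \<in> invariant_probs T" and ent: "code_entropy_ge T e \<mu> g"
    and U: "code T e 1 U" "0 < c" "c \<le> 1" "\<And>x. c \<le> U x"
    and Q: "\<And>n. k \<le> n \<Longrightarrow> code T e n (Q n)"
    and QA: "\<And>n x. k \<le> n \<Longrightarrow> x \<in> A n \<Longrightarrow> exp (- (real n * h)) \<le> Q n x"
    and A: "\<And>n. A n \<in> sets borel"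
    and "0 \<le> h" "0 < \<eta>" and big: "measure \<mu> (\<Inter>m. \<Union>n\<in>{m..}. A n) > 1 - \<eta>"
  shows "g \<le> h + \<eta> + \<eta> * ln (2 / c)"
proof -
  interpret prob_space \<mu> using \<mu> by (simp add: invariant_probs_def borel_probs_def)
  have s: "sets \<mu> = sets borel" using \<mu> by (simp add: invariant_probs_def borel_probs_def)
  have sp: "space \<mu> = UNIV" using \<mu> by (simp add: invariant_probs_def borel_probs_space)
  define K where "K = ln (2 / c)"
  have K: "K \<ge> 0" using U(2,3) by (simp add: K_def)
  have "summable (\<lambda>n. exp (- \<eta>) ^ n)" using \<open>0 < \<eta>\<close> by (intro summable_geometric) simp
  then obtain M where M: "\<And>m n. m \<ge> M \<Longrightarrow> norm (\<Sum>i = m..<n. exp (- \<eta>) ^ i) < 1 / 2"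
    unfolding summable_Cauchy by (metis half_gt_zero zero_less_one)
  \<comment> \<open>m is fixed first, from the geometric tail. The limit superior set lies in the
    union of all \<open>A n\<close> with n at least m, so l can be chosen afterwards.\<close>
  define m where "m = max (max M k) 1"
  have tail: "(\<Sum>n = m..l. exp (- \<eta>) ^ n) \<le> 1 / 2" for l
  proof -
    have "M \<le> m" by (simp add: m_def)
    from M[OF this, of "Suc l"] show ?thesis
      unfolding atLeastLessThanSuc_atLeastAtMost real_norm_def by linarith
  qed
  have lim: "(\<lambda>l. measure \<mu> (\<Union>n\<in>{m..l}. A n)) \<longlonglongrightarrow> measure \<mu> (\<Union>l. \<Union>n\<in>{m..l}. A n)"
  proof (rule finite_Lim_measure_incseq)
    show "incseq (\<lambda>l. \<Union>n\<in>{m..l}. A n)" unfolding incseq_def by (intro allI impI UN_mono) auto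
  qed (use A s in auto)
  have "measure \<mu> (\<Inter>m. \<Union>n\<in>{m..}. A n) \<le> measure \<mu> (\<Union>l. \<Union>n\<in>{m..l}. A n)"
  proof (rule finite_measure_mono)
    have "x \<in> (\<Union>l. \<Union>n\<in>{m..l}. A n)" if x: "x \<in> (\<Union>n\<in>{m..}. A n)" for x
    proof -
      obtain n where "m \<le> n" "x \<in> A n" using x by auto
      then have "x \<in> (\<Union>n\<in>{m..n}. A n)" by auto
      then show ?thesis by blast
    qed
    then show "(\<Inter>m. \<Union>n\<in>{m..}. A n) \<subseteq> (\<Union>l. \<Union>n\<in>{m..l}. A n)" by blast
  qed (use A s in auto)
  then have "\<forall>\<^sub>F l in sequentially. measure \<mu> (\<Union>n\<in>{m..l}. A n) > 1 - \<eta>"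
    using big by (intro order_tendstoD(1)[OF lim]) linarith
  then obtain l where l: "measure \<mu> (\<Union>n\<in>{m..l}. A n) > 1 - \<eta>" by (auto simp: eventually_sequentially)
  define G where "G = (\<Union>n\<in>{m..l}. A n)"
  have G: "G \<in> sets borel" unfolding G_def using A by auto
  have "measure \<mu> (space \<mu> - G) = 1 - measure \<mu> G" using G s by (intro prob_compl) auto
  then have mG: "measure \<mu> (- G) \<le> \<eta>" using l sp by (simp add: G_def Compl_eq_Diff_UNIV)
  have bound: "real N * (g - (h + \<eta> + K * \<eta>)) \<le> K * real l" if "N > 0" for N
  proof -
    define V where "V x = (\<Sum>i<N. indicator (- G) ((T ^^ i) x) :: real)" for x
    have "\<exists>R. code T e N R \<and> (\<forall>x. exp (- (real N * (h + \<eta>) + ln (2 / c) * (\<Sum>i<N. indicator (- (\<Union>n\<in>{m..l}. A n)) ((T ^^ i) x)) + ln (2 / c) * real l)) \<le> R x)"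
      using Q QA \<open>0 \<le> h\<close> \<open>0 < \<eta>\<close> tail
      by (intro concatenated_code[OF U, of m Q A h \<eta> l N]) (auto simp: m_def)
    then obtain R where R: "code T e N R"
      "\<And>x. exp (- (real N * (h + \<eta>) + K * V x + K * real l)) \<le> R x"
      unfolding V_def G_def K_def by blast
    have R_pos: "R x > 0" for x by (rule less_le_trans[OF exp_gt_zero R(2)])
    have le: "- ln (R x) \<le> real N * (h + \<eta>) + K * V x + K * real l" for x
      using R(2)[of x] R_pos[of x] by (metis ln_exp ln_le_cancel_iff exp_gt_zero minus_le_iff)
    have ind: "integrable \<mu> (\<lambda>x. indicator (- G) ((T ^^ i) x) :: real)"
      "(\<integral>x. indicator (- G) ((T ^^ i) x) \<partial>\<mu>) = measure \<mu> (- G)" for i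
    proof -
      have eq: "(\<lambda>x. indicator (- G) ((T ^^ i) x) :: real) = indicator ((T ^^ i) -` (- G))"
        by (auto simp: indicator_def)
      have "(T ^^ i) -` (- G) \<in> sets \<mu>" using invariant_measure_funpow(2)[OF \<mu>, of "- G" i] G s by auto
      then show "integrable \<mu> (\<lambda>x. indicator (- G) ((T ^^ i) x) :: real)"
        unfolding eq by (intro integrable_real_indicator) (simp_all add: emeasure_eq_measure)
      show "(\<integral>x. indicator (- G) ((T ^^ i) x) \<partial>\<mu>) = measure \<mu> (- G)"
        unfolding eq using invariant_measure_funpow(1)[OF \<mu>, of "- G" i] G sp by auto
    qed
    have V: "integrable \<mu> V" "(\<integral>x. V x \<partial>\<mu>) = real N * measure \<mu> (- G)"
      unfolding V_def using ind by (auto simp: integral_sum)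
    have "real N * g \<le> (\<integral>x. - ln (R x) \<partial>\<mu>)"
      using ent R(1) R_pos that by (simp add: code_entropy_ge_def)
    also have "\<dots> \<le> (\<integral>x. real N * (h + \<eta>) + K * V x + K * real l \<partial>\<mu>)"
    proof (rule integral_mono)
      show "integrable \<mu> (\<lambda>x. - ln (R x))"
        using \<mu> R_pos by (intro integrable_continuous_borel_probs[OF compact_UNIV] continuous_on_neg_ln
            continuous_on_code[OF R(1) continuous_T e_pos]) (auto simp: invariant_probs_def)
    qed (use V le in auto)
    also have "\<dots> = real N * (h + \<eta>) + K * (real N * measure \<mu> (- G)) + K * real l"
      using V by (simp add: prob_space)
    also have "\<dots> \<le> real N * (h + \<eta>) + K * (real N * \<eta>) + K * real l"
      using mG K by (intro add_mono mult_left_mono) auto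
    finally show ?thesis by (simp add: algebra_simps)
  qed
  have "g - (h + \<eta> + K * \<eta>) \<le> 0"
  proof (rule ccontr)
    assume *: "\<not> ?thesis"
    then obtain N where N: "K * real l < real N * (g - (h + \<eta> + K * \<eta>))"
      using reals_Archimedean3[of "g - (h + \<eta> + K * \<eta>)"] by auto
    moreover have "N > 0" using N K by (intro Nat.gr0I) (auto simp: mult_less_0_iff)
    ultimately show False using bound[of N] by simp
  qed
  then show ?thesis by (simp add: K_def mult.commute)
qed

text \<open>If Katok's entropy is below h, then for all large n at most \<open>exp (n * h)\<close>
  balls cover a set \<open>A n\<close> of measure above \<delta>. The limit superior B of these sets
  still has measure at least \<delta>, and its preimages under boundedly many iterates have almost
  full measure. Padding the blocks with filler words transfers the codes to these preimages at a
  bounded cost.\<close>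

lemma code_entropy_le_katok:
  assumes \<mu>: "\<mu> \<in> ergodic_measures T" and ent: "code_entropy_ge T e \<mu> g" and "0 < \<delta>" "\<delta> < 1"
  shows "ereal g \<le> katok_entropy T \<mu> e \<delta>"
proof (rule ccontr)
  assume "\<not> ?thesis"
  then obtain h where h: "katok_entropy T \<mu> e \<delta> < ereal h" "h < g"
    by (metis ereal_dense2 less_ereal.simps(1) not_le)
  note inv = ergodic_measures_invariant[OF \<mu>]
  interpret prob_space \<mu> using \<mu> by (simp add: ergodic_measures_def)
  have s: "sets \<mu> = sets borel" using \<mu> by (simp add: ergodic_measures_def)
  define \<kappa> where "\<kappa> n = katok_number T \<mu> \<delta> n e" for n
  have "\<exists>C. finite C \<and> card C = \<kappa> n \<and> measure \<mu> (\<Union>x\<in>C. dyn_ball T n x e) > \<delta>" if "n > 0" for n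
    unfolding \<kappa>_def
    using katok_number_attained[OF compact_UNIV continuous_T that e_pos prob_space_axioms s \<open>\<delta> < 1\<close>] .
  then obtain C where C: "\<And>n. n > 0 \<Longrightarrow> finite (C n)" "\<And>n. n > 0 \<Longrightarrow> card (C n) = \<kappa> n"
    "\<And>n. n > 0 \<Longrightarrow> measure \<mu> (\<Union>x\<in>C n. dyn_ball T n x e) > \<delta>" by metis
  \<comment> \<open>For n = 0 the Bowen metric is a maximum over the empty set; the value {} keeps
    \<open>A 0\<close> Borel.\<close>
  define A where "A n = (if n = 0 then {} else \<Union>x\<in>C n. dyn_ball T n x e)" for n
  have "open (A n)" for n
    unfolding A_def using open_dyn_ball[OF continuous_T] by auto
  then have A: "A n \<in> sets borel" for n by simp
  have C_ne: "C n \<noteq> {}" if "n > 0" for n using C(3)[OF that] \<open>0 < \<delta>\<close> by auto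
  then have \<kappa>: "\<kappa> n \<ge> 1" if "n > 0" for n using C(1,2)[OF that] C_ne[OF that] by (metis Suc_leI card_gt_0_iff One_nat_def that)
  have "\<forall>\<^sub>F n in sequentially. ereal (1 / real n * ln (real (\<kappa> n))) < ereal h"
    using h(1) unfolding katok_entropy_def \<kappa>_def by (rule Limsup_lessD)
  then obtain k0 where k0: "\<And>n. n \<ge> k0 \<Longrightarrow> 1 / real n * ln (real (\<kappa> n)) < h"
    by (auto simp: eventually_sequentially)
  define k where "k = max k0 1"
  have kn: "1 / real (\<kappa> n) \<ge> exp (- (real n * h))" if "n \<ge> k" for n
  proof -
    have "ln (real (\<kappa> n)) \<le> real n * h" using k0[of n] that by (simp add: k_def field_simps)
    then have "real (\<kappa> n) \<le> exp (real n * h)" using \<kappa>[of n] that by (metis exp_le_cancel_iff exp_ln k_def max.bounded_iff less_le_trans of_nat_0_less_iff zero_less_one)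
    then show ?thesis using \<kappa>[of n] that by (simp add: exp_minus k_def field_simps)
  qed
  have "0 \<le> h"
  proof -
    have "1 \<le> real (\<kappa> k)" using \<kappa>[of k] by (simp add: k_def)
    then have "0 \<le> 1 / real k * ln (real (\<kappa> k))" by (intro mult_nonneg_nonneg ln_ge_zero) auto
    also have "\<dots> < h" by (rule k0) (simp add: k_def)
    finally show ?thesis by simp
  qed
  have "\<exists>Q. code T e n Q \<and> (\<forall>x\<in>A n. exp (- (real n * h)) \<le> Q x)" if "n \<ge> k" for n
  proof -
    have "n > 0" using that by (simp add: k_def)
    then obtain Q where "code T e n Q" "\<And>x. x \<in> (\<Union>z\<in>C n. dyn_ball T n z e) \<Longrightarrow> 1 / card (C n) \<le> Q x"
      using code_dyn_balls[OF C(1) C_ne, of n n] by metis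
    then show ?thesis using kn[OF that] C(2)[OF \<open>n > 0\<close>] \<open>n > 0\<close> by (force simp: A_def)
  qed
  then obtain Q where Q: "\<And>n. n \<ge> k \<Longrightarrow> code T e n (Q n)"
    "\<And>n x. n \<ge> k \<Longrightarrow> x \<in> A n \<Longrightarrow> exp (- (real n * h)) \<le> Q n x" by metis
  define B where "B = (\<Inter>m. \<Union>n\<in>{m..}. A n)"
  have B: "B \<in> sets borel" unfolding B_def using A by auto
  have "(\<lambda>m. measure \<mu> (\<Union>n\<in>{m..}. A n)) \<longlonglongrightarrow> measure \<mu> B"
    unfolding B_def
  proof (rule finite_Lim_measure_decseq)
    show "decseq (\<lambda>m. \<Union>n\<in>{m..}. A n)" unfolding decseq_def by (intro allI impI UN_mono) auto
  qed (use A s in auto)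
  moreover have "\<delta> \<le> measure \<mu> (\<Union>n\<in>{m..}. A n)" for m
  proof -
    have "measure \<mu> (A (Suc m)) \<le> measure \<mu> (\<Union>n\<in>{m..}. A n)"
      using A s by (intro finite_measure_mono UN_upper) auto
    then show ?thesis using C(3)[of "Suc m"] by (simp add: A_def)
  qed
  ultimately have "\<delta> \<le> measure \<mu> B" by (intro LIMSEQ_le_const) auto
  then have B_pos: "measure \<mu> B > 0" using \<open>0 < \<delta>\<close> by simp
  obtain U c where U: "\<And>n. code T e n (U n)" "0 < c" "c \<le> 1" "\<And>n x. c ^ n \<le> U n x"
    using uniform_codes by metis
  have main: "g \<le> (h + \<eta>) + \<eta> + \<eta> * ln (2 / c)" if \<eta>: "\<eta> > 0" for \<eta>
  proof -
    obtain J where J: "J > 0" "measure \<mu> (\<Union>j<J. (T ^^ j) -` B) > 1 - \<eta>"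
      using ergodic_hitting[OF \<mu> B B_pos \<eta>] by metis
    \<comment> \<open>For n at least i, the fixed cost of drawing j and writing J filler letters is
      absorbed by \<open>n * \<eta>\<close>.\<close>
    obtain i :: nat where i: "- ln (c ^ J / J) < real i * \<eta>" using reals_Archimedean3[OF \<eta>] by blast
    define A' where "A' n = (\<Union>j<J. (T ^^ j) -` A (n - J))" for n
    \<comment> \<open>A uniformly drawn waiting time j, then j filler letters, a block of length n -
      J, and J - j further filler letters. The second filler makes the total length n independent of
      j; the truncated subtraction is harmless since n is at least J in every use.\<close>
    define Q' where "Q' n x = (\<Sum>j<J. U j x * (Q (n - J) ((T ^^ j) x) * U (J - j) ((T ^^ (n - J)) ((T ^^ j) x)))) / card {..<J}" for n x
    show ?thesis
    proof (rule code_entropy_le_of_covering[where k="k + J + i" and Q=Q' and A=A', OF inv ent])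
      show "code T e 1 (U 1)" "0 < c" "c \<le> 1" "\<And>x. c \<le> U 1 x"
        using U(1)[of 1] U(2,3) U(4)[of 1] by auto
      show "code T e n (Q' n)" if n: "k + J + i \<le> n" for n
        unfolding Q'_def
      proof (rule code_mean)
        fix j assume j: "j \<in> {..<J}"
        have nJ: "n - J \<ge> k" using n by simp
        have "j + (n - J + (J - j)) = n" using j n by auto
        then show "code T e n (\<lambda>x. U j x * (Q (n - J) ((T ^^ j) x) * U (J - j) ((T ^^ (n - J)) ((T ^^ j) x))))"
          using code_mult[OF U(1)[of j] code_mult[OF Q(1)[OF nJ] U(1)[of "J - j"]]] by (simp only:)
      qed (use J in auto)
      show "A' n \<in> sets borel" for n
        unfolding A'_def using invariant_measure_funpow(2)[OF inv A] by auto
      show "exp (- (real n * (h + \<eta>))) \<le> Q' n x" if n: "k + J + i \<le> n" "x \<in> A' n" for n x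
      proof -
        have nJ: "n - J \<ge> k" using n by simp
        obtain j where j: "j < J" "(T ^^ j) x \<in> A (n - J)" using n(2) by (auto simp: A'_def)
        have "real i * \<eta> \<le> real n * \<eta>" using n(1) \<eta> by (intro mult_right_mono) auto
        then have "- (real n * \<eta>) \<le> ln (c ^ J / J)" using i by simp
        then have "exp (- (real n * \<eta>)) \<le> c ^ J / J" using U(2) J(1) by (metis exp_le_cancel_iff exp_ln divide_pos_pos of_nat_0_less_iff zero_less_power)
        moreover have "exp (- (real n * h)) \<le> exp (- (real (n - J) * h))"
          using \<open>0 \<le> h\<close> by (simp add: mult_right_mono)
        ultimately have "exp (- (real n * \<eta>)) * exp (- (real n * h)) \<le> c ^ J / J * exp (- (real (n - J) * h))"
          using U(2) by (intro mult_mono) auto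
        then have "exp (- (real n * (h + \<eta>))) \<le> c ^ J / J * exp (- (real (n - J) * h))"
          by (simp flip: exp_add add: algebra_simps)
        also have "\<dots> = (c ^ j * (exp (- (real (n - J) * h)) * c ^ (J - j))) / J"
          using j(1) by (simp add: power_add[symmetric] mult_ac)
        also have "\<dots> \<le> (U j x * (Q (n - J) ((T ^^ j) x) * U (J - j) ((T ^^ (n - J)) ((T ^^ j) x)))) / J"
          using U(2) code_nonneg[OF U(1)] code_nonneg[OF Q(1)[OF nJ]]
          by (intro divide_right_mono mult_mono U(4) Q(2)[OF nJ j(2)]) auto
        also have "\<dots> \<le> Q' n x"
          unfolding Q'_def card_lessThan
          using j(1) code_nonneg[OF U(1)] code_nonneg[OF Q(1)[OF nJ]]
          by (intro divide_right_mono member_le_sum) auto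
        finally show ?thesis .
      qed
      have "(\<Union>j<J. (T ^^ j) -` B) \<subseteq> (\<Inter>m. \<Union>n\<in>{m..}. A' n)"
      proof
        fix x assume "x \<in> (\<Union>j<J. (T ^^ j) -` B)"
        then obtain j where j: "j < J" "(T ^^ j) x \<in> B" by blast
        have "\<exists>n\<ge>m. x \<in> A' n" for m
        proof -
          obtain n where "n \<ge> m" "(T ^^ j) x \<in> A n" using j(2) by (auto simp: B_def)
          then have "n + J \<ge> m" "x \<in> A' (n + J)" using j(1) by (auto simp: A'_def)
          then show ?thesis by blast
        qed
        then show "x \<in> (\<Inter>m. \<Union>n\<in>{m..}. A' n)" by auto
      qed
      then have "measure \<mu> (\<Union>j<J. (T ^^ j) -` B) \<le> measure \<mu> (\<Inter>m. \<Union>n\<in>{m..}. A' n)"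
        using s invariant_measure_funpow(2)[OF inv A] by (intro finite_measure_mono) (auto simp: A'_def)
      then show "1 - \<eta> < measure \<mu> (\<Inter>m. \<Union>n\<in>{m..}. A' n)" using J(2) by simp
    qed (use \<open>0 \<le> h\<close> \<eta> in auto)
  qed
  define K where "K = ln (2 / c)"
  have "K \<ge> 0" using U(2,3) by (simp add: K_def)
  \<comment> \<open>Chosen so that the error \<open>\<eta> * (2 + K)\<close> is half of the assumed
    gap g - h.\<close>
  define \<eta> where "\<eta> = (g - h) / (2 * (2 + K))"
  have "\<eta> > 0" using h(2) \<open>K \<ge> 0\<close> by (simp add: \<eta>_def)
  have "g - h \<le> \<eta> * (2 + K)" using main[OF \<open>\<eta> > 0\<close>] by (simp add: K_def algebra_simps)
  also have "\<dots> = (g - h) / 2" using \<open>K \<ge> 0\<close> by (simp add: \<eta>_def field_simps)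
  finally show False using h(2) by simp
qed

end

subsection \<open>Empirical measures of separated sets\<close>

context compact_system begin

lemma invariant_probsI:
  assumes "\<nu> \<in> borel_probs"
    and "\<And>f::'a \<Rightarrow> real. continuous_on UNIV f \<Longrightarrow> (\<integral>x. f (T x) \<partial>\<nu>) = (\<integral>x. f x \<partial>\<nu>)"
  shows "\<nu> \<in> invariant_probs T"
proof -
  have s: "sets \<nu> = sets borel" using assms by (simp add: borel_probs_def)
  interpret prob_space \<nu> using assms by (simp add: borel_probs_def)
  have m: "T \<in> measurable \<nu> borel"
    using measurable_funpow[of 1] unfolding measurable_cong_sets[OF s refl, of borel] by simp
  have "distr \<nu> borel T = \<nu>"
  proof (rule borel_probs_eqI_continuous)
    show "distr \<nu> borel T \<in> borel_probs"
      using prob_space_distr[OF m] by (simp add: borel_probs_def)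
    fix f :: "'a \<Rightarrow> real" assume f: "continuous_on UNIV f"
    show "(\<integral>x. f x \<partial>distr \<nu> borel T) = (\<integral>x. f x \<partial>\<nu>)"
      unfolding integral_distr[OF m borel_measurable_continuous_onI[OF f]] by (rule assms(2)[OF f])
  qed (rule assms(1))
  then show ?thesis using assms(1) by (simp add: invariant_probs_def)
qed

lemma continuous_on_comp_T:
  fixes f :: "'a \<Rightarrow> 'b::topological_space"
  shows "continuous_on UNIV f \<Longrightarrow> continuous_on UNIV (\<lambda>x. f (T x))"
  using continuous_on_compose2[OF _ continuous_T] by blast

lemma invariant_probs_limit:
  assumes "weakly_converges \<nu> \<mu>" "\<mu> \<in> borel_probs"
    and "\<And>f::'a \<Rightarrow> real. continuous_on UNIV f \<Longrightarrow>
      (\<lambda>n. (\<integral>x. f (T x) \<partial>\<nu> n) - (\<integral>x. f x \<partial>\<nu> n)) \<longlonglongrightarrow> 0"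
  shows "\<mu> \<in> invariant_probs T"
proof (rule invariant_probsI[OF assms(2)])
  fix f :: "'a \<Rightarrow> real" assume f: "continuous_on UNIV f"
  have "(\<lambda>n. (\<integral>x. f (T x) \<partial>\<nu> n) - (\<integral>x. f x \<partial>\<nu> n)) \<longlonglongrightarrow> (\<integral>x. f (T x) \<partial>\<mu>) - (\<integral>x. f x \<partial>\<mu>)"
    using assms(1) f continuous_on_comp_T[OF f] by (intro tendsto_diff) (auto simp: weakly_converges_def)
  from LIMSEQ_unique[OF this assms(3)[OF f]] show "(\<integral>x. f (T x) \<partial>\<mu>) = (\<integral>x. f x \<partial>\<mu>)" by simp
qed

lemma weakly_convergesD:
  fixes f :: "'a \<Rightarrow> real"
  shows "weakly_converges \<nu> \<mu> \<Longrightarrow> continuous_on UNIV f \<Longrightarrow>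
    (\<lambda>n. \<integral>x. f x \<partial>\<nu> n) \<longlonglongrightarrow> (\<integral>x. f x \<partial>\<mu>)"
  by (simp add: weakly_converges_def)

lemma code_entropy_ge_limit:
  assumes "weakly_converges \<nu> \<mu>" "\<And>k. code_entropy_ge T e (\<nu> k) (g k)" "g \<longlonglongrightarrow> h"
  shows "code_entropy_ge T e \<mu> h"
  unfolding code_entropy_ge_def
proof (intro allI impI)
  fix n Q assume Q: "n > 0" "code T e n Q" "\<forall>x. Q x > 0"
  have "continuous_on UNIV (\<lambda>x. - ln (Q x))"
    using Q by (intro continuous_on_neg_ln continuous_on_code[OF _ continuous_T e_pos]) auto
  then have "(\<lambda>k. \<integral>x. - ln (Q x) \<partial>\<nu> k) \<longlonglongrightarrow> (\<integral>x. - ln (Q x) \<partial>\<mu>)"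
    by (rule weakly_convergesD[OF assms(1)])
  moreover have "(\<lambda>k. real n * g k) \<longlonglongrightarrow> real n * h" using assms(3) by (intro tendsto_intros)
  moreover have "real n * g k \<le> (\<integral>x. - ln (Q x) \<partial>\<nu> k)" for k
    using assms(2) Q by (simp add: code_entropy_ge_def)
  ultimately show "real n * h \<le> (\<integral>x. - ln (Q x) \<partial>\<mu>)" by (intro LIMSEQ_le) auto
qed

lemma integrable_neg_ln_code:
  assumes "\<mu> \<in> borel_probs" "code T e n Q" "\<And>x. Q x > 0"
  shows "integrable \<mu> (\<lambda>x. - ln (Q x))"
  using assms by (intro integrable_continuous_borel_probs[OF compact_UNIV] continuous_on_neg_ln
      continuous_on_code[OF _ continuous_T e_pos]) auto

text \<open>Jensen's inequality in the form ln y \<le> y - 1 with \<open>y = P x * card E\<close>: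
  summed over E, the right-hand side is at most 0 because the values of P add up to at most
  1.\<close>

lemma ln_card_le_code:
  assumes "code T e N P" "\<And>x. P x > 0" "finite E" "E \<noteq> {}" "N > 0" "dyn_separated T N (4 * e) E"
  shows "card E * ln (card E) \<le> (\<Sum>x\<in>E. - ln (P x))"
proof -
  define m where "m = real (card E)"
  have m: "m > 0" using assms by (simp add: m_def card_gt_0_iff)
  have "(\<Sum>x\<in>E. ln (P x) + ln m) \<le> (\<Sum>x\<in>E. P x * m - 1)"
  proof (rule sum_mono)
    fix x show "ln (P x) + ln m \<le> P x * m - 1"
      using assms(2)[of x] m ln_le_minus_one[of "P x * m"] by (simp add: ln_mult)
  qed
  also have "\<dots> = (\<Sum>x\<in>E. P x) * m - m" by (simp add: sum_subtractf sum_distrib_right m_def)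
  also have "\<dots> \<le> 0"
    using code_separated_sum_le[OF assms(1) e_pos assms(5,3,6)] m by simp
  finally show ?thesis by (simp add: sum.distrib sum_negf m_def)
qed

text \<open>Misiurewicz's averaging over offsets. For each r < n the time interval is cut into r
  filler letters, blocks of length n coded by Q, and a remainder of fewer than n filler letters. The
  two fillers cost at most \<open>2 * n * (- ln c)\<close> for each r, and summing over the n
  offsets gives the factor \<open>n^2\<close>.\<close>

lemma separated_orbit_average:
  assumes Q: "code T e n Q" "\<And>x. Q x > 0" and "n > 0" "n \<le> N"
    and E: "finite E" "E \<noteq> {}" "dyn_separated T N (4 * e) E"
    and U: "\<And>n. code T e n (U n)" "0 < c" "c \<le> 1" "\<And>n x. c ^ n \<le> U n x"
  shows "n * ln (card E) \<le> 2 * n^2 * (- ln c) + (\<Sum>x\<in>E. \<Sum>i<N. - ln (Q ((T ^^ i) x))) / card E"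
proof -
  define L where "L x = - ln (Q x)" for x
  have L: "L x \<ge> 0" for x using code_le_1[OF Q(1)] Q(2) by (simp add: L_def)
  have lnc: "- ln c \<ge> 0" using U by simp
  have m: "real (card E) > 0" using E by (simp add: card_gt_0_iff)
  have *: "card E * ln (card E) \<le> card E * (2 * n * (- ln c)) + (\<Sum>x\<in>E. \<Sum>j<(N - r) div n. L ((T ^^ (r + n * j)) x))"
    if r: "r < n" for r
  proof -
    define k where "k = (N - r) div n"
    define s where "s = (N - r) mod n"
    have N: "r + (n * k + s) = N" using r \<open>n \<le> N\<close> by (simp add: k_def s_def)
    have s: "s < n" using \<open>n > 0\<close> by (simp add: s_def)
    define P where "P x = U r x * ((\<Prod>j<k. Q ((T ^^ (n * j)) ((T ^^ r) x))) * U s ((T ^^ (n * k)) ((T ^^ r) x)))" for x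
    have "code T e (r + (n * k + s)) P"
      unfolding P_def by (rule code_mult[OF U(1) code_mult[OF code_power[OF Q(1)] U(1)]])
    then have P: "code T e N P" unfolding N .
    have U_pos: "U i x > 0" for i x using U(2) U(4)[of i x] by (intro less_le_trans[OF _ U(4)]) simp
    have P_pos: "P x > 0" for x unfolding P_def using U_pos Q(2) by (intro mult_pos_pos prod_pos) auto
    have lnU: "- ln (U i x) \<le> real n * (- ln c)" if "i < n" for i x
    proof -
      have "ln (c ^ i) \<le> ln (U i x)" using U(2) U(4)[of i x] U_pos by (subst ln_le_cancel_iff) auto
      then have "- ln (U i x) \<le> real i * (- ln c)" using U(2) by (simp add: ln_realpow)
      also have "\<dots> \<le> real n * (- ln c)" using that lnc by (intro mult_right_mono) auto
      finally show ?thesis .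
    qed
    have "- ln (P x) \<le> 2 * n * (- ln c) + (\<Sum>j<k. L ((T ^^ (r + n * j)) x))" for x
    proof -
      have "ln (P x) = ln (U r x) + (ln (\<Prod>j<k. Q ((T ^^ (n * j)) ((T ^^ r) x))) + ln (U s ((T ^^ (n * k)) ((T ^^ r) x))))"
        unfolding P_def using U_pos[THEN less_imp_neq, THEN not_sym] Q(2)[THEN less_imp_neq, THEN not_sym]
        by (simp add: ln_mult)
      also have "ln (\<Prod>j<k. Q ((T ^^ (n * j)) ((T ^^ r) x))) = (\<Sum>j<k. ln (Q ((T ^^ (n * j)) ((T ^^ r) x))))"
        using Q(2)[THEN less_imp_neq, THEN not_sym] by (intro ln_prod) auto
      also have "\<dots> = - (\<Sum>j<k. L ((T ^^ (r + n * j)) x))"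
        by (simp add: L_def sum_negf funpow_add add.commute[of r])
      finally show ?thesis using lnU[OF r, of x] lnU[OF s, of "(T ^^ (n * k)) ((T ^^ r) x)"] by simp
    qed
    then have "(\<Sum>x\<in>E. - ln (P x)) \<le> (\<Sum>x\<in>E. 2 * n * (- ln c) + (\<Sum>j<k. L ((T ^^ (r + n * j)) x)))"
      by (rule sum_mono)
    also have "\<dots> = card E * (2 * n * (- ln c)) + (\<Sum>x\<in>E. \<Sum>j<k. L ((T ^^ (r + n * j)) x))"
      by (simp add: sum.distrib sum_subtractf)
    finally show ?thesis
      using ln_card_le_code[OF P P_pos E(1,2) _ E(3)] \<open>n > 0\<close> \<open>n \<le> N\<close> unfolding k_def by linarith
  qed
  \<comment> \<open>Every time is \<open>r + n * j\<close> for a unique r < n and j, so none is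
    counted twice. Times at which no block starts may be added since L is nonnegative, codes being
    bounded by 1.\<close>
  have orbit: "(\<Sum>r<n. \<Sum>j<(N - r) div n. L ((T ^^ (r + n * j)) x)) \<le> (\<Sum>i<N. L ((T ^^ i) x))" for x
  proof -
    define S where "S = Sigma {..<n} (\<lambda>r. {..<(N - r) div n})"
    have inj: "inj_on (\<lambda>(r, j). r + n * j) S"
    proof (rule inj_onI, clarify)
      fix r j r' j' assume a: "(r, j) \<in> S" "(r', j') \<in> S" "r + n * j = r' + n * j'"
      then have "r < n" "r' < n" by (auto simp: S_def)
      then have "(r + n * j) mod n = r" "(r' + n * j') mod n = r'" "(r + n * j) div n = j" "(r' + n * j') div n = j'" by auto
      then show "r = r' \<and> j = j'" using a(3) by metis
    qed
    have sub: "(\<lambda>(r, j). r + n * j) ` S \<subseteq> {..<N}"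
    proof (rule image_subsetI)
      fix p assume "p \<in> S"
      then obtain r j where p: "p = (r, j)" "r < n" "Suc j \<le> (N - r) div n" by (auto simp: S_def)
      from p(3) have "n * Suc j \<le> n * ((N - r) div n)" by (intro mult_le_mono2)
      also have "\<dots> \<le> N - r" by simp
      finally show "(case p of (r, j) \<Rightarrow> r + n * j) \<in> {..<N}" using p(1,2) by simp
    qed
    have "(\<Sum>r<n. \<Sum>j<(N - r) div n. L ((T ^^ (r + n * j)) x)) = (\<Sum>(r, j)\<in>S. L ((T ^^ (r + n * j)) x))"
      unfolding S_def by (rule sum.Sigma) auto
    also have "\<dots> = (\<Sum>i\<in>(\<lambda>(r, j). r + n * j) ` S. L ((T ^^ i) x))"
      by (subst sum.reindex[OF inj]) (simp add: case_prod_unfold)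
    also have "\<dots> \<le> (\<Sum>i<N. L ((T ^^ i) x))"
      using sub L by (intro sum_mono2) auto
    finally show ?thesis .
  qed
  have "n * (card E * ln (card E)) = (\<Sum>r<n. card E * ln (card E))" by simp
  also have "\<dots> \<le> (\<Sum>r<n. card E * (2 * n * (- ln c)) + (\<Sum>x\<in>E. \<Sum>j<(N - r) div n. L ((T ^^ (r + n * j)) x)))"
    using * by (intro sum_mono) simp
  also have "\<dots> = n * (card E * (2 * n * (- ln c))) + (\<Sum>x\<in>E. \<Sum>r<n. \<Sum>j<(N - r) div n. L ((T ^^ (r + n * j)) x))"
    by (simp add: sum.distrib sum_subtractf sum.swap[of _ E])
  also have "\<dots> \<le> n * (card E * (2 * n * (- ln c))) + (\<Sum>x\<in>E. \<Sum>i<N. L ((T ^^ i) x))"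
    using orbit by (intro add_left_mono sum_mono)
  finally have "card E * (n * ln (card E)) \<le> card E * (2 * n^2 * (- ln c)) + (\<Sum>x\<in>E. \<Sum>i<N. L ((T ^^ i) x))"
    by (simp add: power2_eq_square algebra_simps)
  then show ?thesis using m unfolding L_def by (simp add: field_simps)
qed

text \<open>The average over E of the empirical measures of orbit segments of length N, obtained as
  the image of a uniform distribution.\<close>

definition orbit_measure :: "'a set \<Rightarrow> nat \<Rightarrow> 'a measure" where
  "orbit_measure E N = distr (measure_pmf (pmf_of_set (E \<times> {..<N}))) borel (\<lambda>(x, i). (T ^^ i) x)"

lemma orbit_measure_borel_probs: "orbit_measure E N \<in> borel_probs"
  unfolding orbit_measure_def borel_probs_def
  by (auto intro!: measure_pmf.prob_space_distr)

lemma integral_orbit_measure: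
  fixes f :: "'a \<Rightarrow> real"
  assumes "finite E" "E \<noteq> {}" "N > 0" "continuous_on UNIV f"
  shows "(\<integral>x. f x \<partial>orbit_measure E N) = (\<Sum>x\<in>E. \<Sum>i<N. f ((T ^^ i) x)) / (card E * N)"
proof -
  have "(\<integral>x. f x \<partial>orbit_measure E N) = (\<integral>p. f (case p of (x, i) \<Rightarrow> (T ^^ i) x) \<partial>measure_pmf (pmf_of_set (E \<times> {..<N})))"
    unfolding orbit_measure_def
    by (rule integral_distr) (auto intro: borel_measurable_continuous_onI assms)
  also have "\<dots> = (\<Sum>p\<in>E \<times> {..<N}. f (case p of (x, i) \<Rightarrow> (T ^^ i) x)) / card (E \<times> {..<N})"
    using assms by (intro integral_pmf_of_set) auto
  also have "(\<Sum>p\<in>E \<times> {..<N}. f (case p of (x, i) \<Rightarrow> (T ^^ i) x)) = (\<Sum>x\<in>E. \<Sum>i<N. f ((T ^^ i) x))"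
    by (simp add: sum.cartesian_product case_prod_unfold)
  finally show ?thesis by (simp add: card_cartesian_product)
qed

lemma max_separated_set:
  assumes "N > 0"
  obtains E where "finite E" "E \<noteq> {}" "dyn_separated T N (4 * e) E" "card E = sep_number T UNIV N (4 * e)"
proof -
  define S where "S = {card E |E. E \<subseteq> (UNIV::'a set) \<and> finite E \<and> dyn_separated T N (4 * e) E}"
  have S: "finite S" "S \<noteq> {}"
    unfolding S_def using finite_dyn_separated_cards[OF compact_UNIV continuous_T assms, of "4 * e" UNIV] e_pos by auto
  \<comment> \<open>A one-point set is separated, so the maximal cardinality is at least 1;
    \<open>undefined\<close> serves as an arbitrary point.\<close>
  have "card {undefined :: 'a} \<in> S" unfolding S_def
    by (auto simp: dyn_separated_def intro!: exI[of _ "{undefined}"])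
  then have ge: "1 \<le> Max S" using Max_ge[OF S(1)] by fastforce
  have "Max S \<in> S" using Max_in[OF S] .
  then obtain E where E: "finite E" "dyn_separated T N (4 * e) E" "card E = Max S" unfolding S_def by auto
  moreover have "E \<noteq> {}" using E(3) ge by auto
  ultimately show ?thesis using that unfolding S_def sep_number_def by blast
qed

text \<open>Infinitely many lengths \<open>N k\<close> have separated sets larger than
  \<open>exp (N k * h)\<close>. For the orbit measures of these sets, the integrals of f and of f
  composed with T differ by a telescoping sum, at most \<open>2 * B / N k\<close>, so the weak limit
  is invariant. The block length n of the tested code stays fixed, so the filler cost C is
  negligible against \<open>N k\<close>.\<close>

lemma exists_invariant_code_entropy_ge:
  assumes "ereal h < sep_growth T UNIV (4 * e)"
  obtains \<nu> where "\<nu> \<in> invariant_probs T" "code_entropy_ge T e \<nu> h"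
proof -
  have "\<exists>N>k. h < 1 / real N * ln (real (sep_number T UNIV N (4 * e)))" for k :: nat
  proof (rule ccontr)
    assume "\<not> ?thesis"
    then have "\<forall>\<^sub>F N in sequentially. ereal (1 / real N * ln (real (sep_number T UNIV N (4 * e)))) \<le> ereal h"
      by (intro eventually_mono[OF eventually_gt_at_top[of k]]) (force simp: not_less)
    then have "sep_growth T UNIV (4 * e) \<le> ereal h" unfolding sep_growth_def by (rule Limsup_bounded)
    then show False using assms by simp
  qed
  then obtain N where N: "\<And>k. N k > k" "\<And>k. h < 1 / real (N k) * ln (real (sep_number T UNIV (N k) (4 * e)))"
    by metis
  have N_pos: "N k > 0" for k using N(1)[of k] by simp
  have "\<exists>E. finite E \<and> E \<noteq> {} \<and> dyn_separated T (N k) (4 * e) E \<and> card E = sep_number T UNIV (N k) (4 * e)" for k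
    using max_separated_set[OF N_pos[of k]] by metis
  then obtain E where E: "\<And>k. finite (E k)" "\<And>k. E k \<noteq> {}" "\<And>k. dyn_separated T (N k) (4 * e) (E k)"
    "\<And>k. card (E k) = sep_number T UNIV (N k) (4 * e)" by metis
  obtain U c where U: "\<And>n. code T e n (U n)" "0 < c" "c \<le> 1" "\<And>n x. c ^ n \<le> U n x"
    using uniform_codes by metis
  have N_lim: "(\<lambda>k. C / real (N k)) \<longlonglongrightarrow> 0" for C
  proof -
    have "filterlim (\<lambda>k. real (N k)) at_top sequentially"
      unfolding filterlim_at_top
    proof
      fix Z :: real
      show "\<forall>\<^sub>F k in sequentially. Z \<le> real (N k)"
        using eventually_ge_at_top[of "nat \<lceil>Z\<rceil>"]
      proof eventually_elim
        case (elim k)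
        then show ?case using N(1)[of k] by linarith
      qed
    qed
    then show ?thesis by (rule real_tendsto_divide_at_top[OF tendsto_const])
  qed
  define \<nu> where "\<nu> k = orbit_measure (E k) (N k)" for k
  have "\<nu> k \<in> borel_probs" for k unfolding \<nu>_def by (rule orbit_measure_borel_probs)
  then obtain r \<mu> where r: "strict_mono r" "\<mu> \<in> borel_probs" "weakly_converges (\<nu> \<circ> r) \<mu>"
    using borel_probs_seq_compact[OF compact_UNIV] by metis
  have int: "(\<integral>x. f x \<partial>\<nu> k) = (\<Sum>x\<in>E k. \<Sum>i<N k. f ((T ^^ i) x)) / (card (E k) * N k)"
    if "continuous_on UNIV f" for f :: "'a \<Rightarrow> real" and k
    unfolding \<nu>_def by (rule integral_orbit_measure[OF E(1,2) N_pos that])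
  have cE: "real (card (E k)) > 0" for k using E(1,2) by (simp add: card_gt_0_iff)
  show ?thesis
  proof (rule that[of \<mu>])
    show "\<mu> \<in> invariant_probs T"
    proof (rule invariant_probs_limit[OF r(3,2)])
      fix f :: "'a \<Rightarrow> real" assume f: "continuous_on UNIV f"
      obtain B where B: "\<And>x. \<bar>f x\<bar> \<le> B" using compact_UNIV_continuous_bounded[OF compact_UNIV f] by metis
      have bd: "\<bar>(\<integral>x. f (T x) \<partial>\<nu> k) - (\<integral>x. f x \<partial>\<nu> k)\<bar> \<le> 2 * B / N k" for k
      proof -
        have "(\<Sum>i<n. f (T ((T ^^ i) x))) - (\<Sum>i<n. f ((T ^^ i) x)) = f ((T ^^ n) x) - f x" for n x
          by (induction n) auto
        then have "(\<integral>x. f (T x) \<partial>\<nu> k) - (\<integral>x. f x \<partial>\<nu> k) = (\<Sum>x\<in>E k. f ((T ^^ N k) x) - f x) / (card (E k) * N k)"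
          unfolding int[OF f] int[OF continuous_on_comp_T[OF f]]
          by (simp add: diff_divide_distrib[symmetric] sum_subtractf[symmetric] funpow_swap1)
        also have "\<bar>\<dots>\<bar> \<le> (\<Sum>x\<in>E k. 2 * B) / (card (E k) * N k)"
        proof -
          have "\<bar>\<Sum>x\<in>E k. f ((T ^^ N k) x) - f x\<bar> \<le> (\<Sum>x\<in>E k. 2 * B)"
          proof (rule order_trans[OF sum_abs sum_mono])
            fix x show "\<bar>f ((T ^^ N k) x) - f x\<bar> \<le> 2 * B"
              using B[of "(T ^^ N k) x"] B[of x] by linarith
          qed
          from divide_right_mono[OF this, of "card (E k) * N k"] show ?thesis
            by (simp only: abs_divide abs_mult abs_of_nat of_nat_0_le_iff)
        qed
        also have "\<dots> = 2 * B / N k" using cE[of k] by simp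
        finally show ?thesis .
      qed
      have "(\<lambda>k. (\<integral>x. f (T x) \<partial>\<nu> k) - (\<integral>x. f x \<partial>\<nu> k)) \<longlonglongrightarrow> 0"
        using bd by (intro Lim_null_comparison[OF _ N_lim[of "2 * B"]] always_eventually allI) (simp only: real_norm_def)
      from LIMSEQ_subseq_LIMSEQ[OF this r(1)]
      show "(\<lambda>n. (\<integral>x. f (T x) \<partial>(\<nu> \<circ> r) n) - (\<integral>x. f x \<partial>(\<nu> \<circ> r) n)) \<longlonglongrightarrow> 0"
        by (simp add: o_def)
    qed
    show "code_entropy_ge T e \<mu> h"
      unfolding code_entropy_ge_def
    proof (intro allI impI)
      fix n Q assume Q: "n > 0" "code T e n Q" "\<forall>x. Q x > 0"
      define C where "C = 2 * real n ^ 2 * (- ln c)"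
      have cont: "continuous_on UNIV (\<lambda>x. - ln (Q x))"
        using Q by (intro continuous_on_neg_ln continuous_on_code[OF _ continuous_T e_pos]) auto
      have "real n * h \<le> C / N k + (\<integral>x. - ln (Q x) \<partial>\<nu> k)" if "k \<ge> n" for k
      proof -
        have "n \<le> N k" using that N(1)[of k] by simp
        then have "n * ln (card (E k)) \<le> C + (\<Sum>x\<in>E k. \<Sum>i<N k. - ln (Q ((T ^^ i) x))) / card (E k)"
          unfolding C_def using Q by (intro separated_orbit_average[OF _ _ _ _ E(1,2,3) U]) auto
        then have "n * ln (card (E k)) / N k \<le> (C + (\<Sum>x\<in>E k. \<Sum>i<N k. - ln (Q ((T ^^ i) x))) / card (E k)) / N k"
          by (rule divide_right_mono) simp
        moreover have "real n * h \<le> n * ln (card (E k)) / N k"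
          using N(2)[of k] unfolding E(4) by (simp add: mult_left_mono less_imp_le times_divide_eq_right[symmetric] del: times_divide_eq_right)
        ultimately show ?thesis unfolding int[OF cont] by (simp add: add_divide_distrib)
      qed
      then have "\<forall>\<^sub>F k in sequentially. real n * h \<le> C / N (r k) + (\<integral>x. - ln (Q x) \<partial>\<nu> (r k))"
        using seq_suble[OF r(1)] order_trans by (intro eventually_sequentiallyI[of n]) blast
      moreover have "(\<lambda>k. C / N (r k) + (\<integral>x. - ln (Q x) \<partial>\<nu> (r k))) \<longlonglongrightarrow> 0 + (\<integral>x. - ln (Q x) \<partial>\<mu>)"
        using LIMSEQ_subseq_LIMSEQ[OF N_lim[of C] r(1)] weakly_convergesD[OF r(3) cont]
        unfolding o_def by (rule tendsto_add)
      ultimately show "real n * h \<le> (\<integral>x. - ln (Q x) \<partial>\<mu>)"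
        using tendsto_lowerbound[of _ _ sequentially "real n * h"] by simp
    qed
  qed
qed

end

subsection \<open>Ergodic measures of maximal code entropy\<close>

text \<open>For a bounded separating sequence of continuous functions this is weakly continuous and
  strictly convex, and its maximisers on a face are therefore extreme.\<close>

definition moment_energy :: "(nat \<Rightarrow> 'a \<Rightarrow> real) \<Rightarrow> 'a measure \<Rightarrow> real" where
  "moment_energy f \<mu> = (\<Sum>k. (1 / 2) ^ k * (\<integral>x. f k x \<partial>\<mu>)\<^sup>2)"

context compact_system begin

lemma code_entropy_ge_mono: "code_entropy_ge T e \<mu> h \<Longrightarrow> h' \<le> h \<Longrightarrow> code_entropy_ge T e \<mu> h'"
  unfolding code_entropy_ge_def by (meson mult_left_mono of_nat_0_le_iff order_trans)

text \<open>By invariance every block costs the same on average. Codes of different lengths can thus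
  be raised to a common length without changing their cost per letter.\<close>

lemma integral_neg_ln_power:
  assumes \<mu>: "\<mu> \<in> invariant_probs T" and Q: "code T e n Q" "\<And>x. Q x > 0"
  shows "(\<integral>x. - ln (\<Prod>j<k. Q ((T ^^ (n * j)) x)) \<partial>\<mu>) = real k * (\<integral>x. - ln (Q x) \<partial>\<mu>)"
proof -
  have cont: "continuous_on UNIV (\<lambda>x. - ln (Q x))"
    using Q by (intro continuous_on_neg_ln continuous_on_code[OF _ continuous_T e_pos]) auto
  have bp: "\<mu> \<in> borel_probs" using \<mu> by (simp add: invariant_probs_def)
  have int: "integrable \<mu> (\<lambda>x. - ln (Q ((T ^^ j) x)))" for j
    using continuous_on_compose2[OF cont continuous_on_funpow[OF continuous_T]]
    by (intro integrable_continuous_borel_probs[OF compact_UNIV bp]) auto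
  have "(\<integral>x. - ln (\<Prod>j<k. Q ((T ^^ (n * j)) x)) \<partial>\<mu>) = (\<integral>x. (\<Sum>j<k. - ln (Q ((T ^^ (n * j)) x))) \<partial>\<mu>)"
    using Q(2)[THEN less_imp_neq, THEN not_sym] by (intro Bochner_Integration.integral_cong refl) (simp add: ln_prod sum_negf)
  also have "\<dots> = (\<Sum>j<k. \<integral>x. - ln (Q ((T ^^ (n * j)) x)) \<partial>\<mu>)"
    using int by (intro Bochner_Integration.integral_sum)
  also have "\<dots> = (\<Sum>j<k. \<integral>x. - ln (Q x) \<partial>\<mu>)"
    by (intro sum.cong refl invariant_integral_funpow[OF \<mu> borel_measurable_continuous_onI[OF cont]])
  finally show ?thesis by simp
qed

text \<open>The uniform one-letter code costs at most \<open>- ln c\<close> under every measure, so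
  the supremum over measures is finite.\<close>

lemma code_entropy_bounded:
  obtains K where "\<And>\<mu> h. \<mu> \<in> borel_probs \<Longrightarrow> code_entropy_ge T e \<mu> h \<Longrightarrow> h \<le> K"
proof -
  obtain U c where U: "code T e 1 U" "0 < c" "c \<le> 1" "\<And>x. c \<le> U x"
    using uniform_code_1 by metis
  have U_pos: "U x > 0" for x using U(2) U(4)[of x] by linarith
  have "h \<le> - ln c" if \<mu>: "\<mu> \<in> borel_probs" "code_entropy_ge T e \<mu> h" for \<mu> h
  proof -
    interpret prob_space \<mu> using \<mu> by (simp add: borel_probs_def)
    have "real 1 * h \<le> (\<integral>x. - ln (U x) \<partial>\<mu>)"
      using \<mu>(2) U(1) U_pos zero_less_one unfolding code_entropy_ge_def by blast
    also have "\<dots> \<le> (\<integral>x. - ln c \<partial>\<mu>)"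
      using U(2,4) U_pos by (intro integral_mono integrable_neg_ln_code[OF \<mu>(1) U(1)]) auto
    finally show ?thesis by (simp add: prob_space)
  qed
  then show ?thesis using that by blast
qed

lemma invariant_code_entropy_limit:
  assumes "\<And>k. \<nu> k \<in> invariant_probs T" "\<And>k. code_entropy_ge T e (\<nu> k) (g k)" "g \<longlonglongrightarrow> h"
  obtains r \<mu> where "strict_mono r" "\<mu> \<in> invariant_probs T" "weakly_converges (\<nu> \<circ> r) \<mu>"
    "code_entropy_ge T e \<mu> h"
proof -
  have bp: "\<nu> k \<in> borel_probs" for k using assms(1) by (simp add: invariant_probs_def)
  then obtain r \<mu> where r: "strict_mono r" "\<mu> \<in> borel_probs" "weakly_converges (\<nu> \<circ> r) \<mu>"
    using borel_probs_seq_compact[OF compact_UNIV] by metis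
  have "\<mu> \<in> invariant_probs T"
  proof (rule invariant_probs_limit[OF r(3,2)])
    fix f :: "'a \<Rightarrow> real" assume "continuous_on UNIV f"
    then have "(\<integral>x. f ((T ^^ 1) x) \<partial>\<nu> k) = (\<integral>x. f x \<partial>\<nu> k)" for k
      by (intro invariant_integral_funpow assms borel_measurable_continuous_onI)
    then show "(\<lambda>n. (\<integral>x. f (T x) \<partial>(\<nu> \<circ> r) n) - (\<integral>x. f x \<partial>(\<nu> \<circ> r) n)) \<longlonglongrightarrow> 0" by simp
  qed
  moreover have "code_entropy_ge T e \<mu> h"
    using assms(2) LIMSEQ_subseq_LIMSEQ[OF assms(3) r(1)]
    by (intro code_entropy_ge_limit[OF r(3), of "g \<circ> r"]) auto
  ultimately show ?thesis using that r by blast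
qed

lemma max_code_entropy:
  assumes "\<nu> \<in> invariant_probs T" "code_entropy_ge T e \<nu> h"
  obtains h' \<mu> where "h \<le> h'" "\<mu> \<in> invariant_probs T" "code_entropy_ge T e \<mu> h'"
    "\<And>\<xi> g. \<xi> \<in> invariant_probs T \<Longrightarrow> code_entropy_ge T e \<xi> g \<Longrightarrow> g \<le> h'"
proof -
  define S where "S = {g. \<exists>\<xi>\<in>invariant_probs T. code_entropy_ge T e \<xi> g}"
  obtain K where "\<And>\<mu> h. \<mu> \<in> borel_probs \<Longrightarrow> code_entropy_ge T e \<mu> h \<Longrightarrow> h \<le> K"
    using code_entropy_bounded by metis
  then have bdd: "bdd_above S" unfolding S_def invariant_probs_def by (auto intro!: bdd_aboveI[of _ K])
  have "h \<in> S" using assms by (auto simp: S_def)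
  have "\<exists>\<xi>\<in>invariant_probs T. code_entropy_ge T e \<xi> (Sup S - 1 / Suc k)" for k :: nat
  proof -
    have "Sup S - 1 / Suc k < Sup S" by simp
    then obtain g where "g \<in> S" "Sup S - 1 / Suc k < g" using less_cSup_iff[OF _ bdd] \<open>h \<in> S\<close> by blast
    then show ?thesis unfolding S_def using code_entropy_ge_mono less_imp_le by blast
  qed
  then obtain \<xi> where \<xi>: "\<And>k. \<xi> k \<in> invariant_probs T" "\<And>k. code_entropy_ge T e (\<xi> k) (Sup S - 1 / Suc k)"
    by metis
  have lim: "(\<lambda>k. Sup S - 1 / real (Suc k)) \<longlonglongrightarrow> Sup S"
    using tendsto_diff[OF tendsto_const[of "Sup S"] LIMSEQ_inverse_real_of_nat]
    by (simp add: inverse_eq_divide)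
  obtain \<mu> where "\<mu> \<in> invariant_probs T" "code_entropy_ge T e \<mu> (Sup S)"
    using invariant_code_entropy_limit[OF \<xi> lim] by metis
  moreover have "h \<le> Sup S" by (rule cSup_upper[OF \<open>h \<in> S\<close> bdd])
  moreover have "g \<le> Sup S" if "\<xi> \<in> invariant_probs T" "code_entropy_ge T e \<xi> g" for \<xi> g
    using that by (intro cSup_upper[OF _ bdd]) (auto simp: S_def)
  ultimately show ?thesis using that by blast
qed

text \<open>
  The code entropy is convex up to the cost ln 2 of merging two codes, which is negligible
  for long blocks. Hence the measures of maximal entropy form a face.
\<close>

lemma code_entropy_face:
  assumes \<nu>: "\<nu> \<in> invariant_probs T" "code_entropy_ge T e \<nu> h"
    and max: "\<And>\<xi> g. \<xi> \<in> invariant_probs T \<Longrightarrow> code_entropy_ge T e \<xi> g \<Longrightarrow> g \<le> h"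
    and \<nu>12: "\<nu>1 \<in> invariant_probs T" "\<nu>2 \<in> invariant_probs T"
    and t: "0 < t" "t < 1"
    and mix: "\<And>f::'a \<Rightarrow> real. continuous_on UNIV f \<Longrightarrow>
      (\<integral>x. f x \<partial>\<nu>) = t * (\<integral>x. f x \<partial>\<nu>1) + (1 - t) * (\<integral>x. f x \<partial>\<nu>2)"
  shows "code_entropy_ge T e \<nu>1 h"
proof (rule ccontr)
  assume "\<not> ?thesis"
  then obtain n Q where Q: "n > 0" "code T e n Q" "\<And>x. Q x > 0" "(\<integral>x. - ln (Q x) \<partial>\<nu>1) < real n * h"
    unfolding code_entropy_ge_def by (auto simp: not_le)
  define a where "a = (\<integral>x. - ln (Q x) \<partial>\<nu>1)"
  define \<alpha> where "\<alpha> = h - a / n"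
  have \<alpha>: "\<alpha> > 0" "a = real n * (h - \<alpha>)" using Q(1,4) by (auto simp: \<alpha>_def a_def field_simps)
  \<comment> \<open>The value is such that a surplus b of \<nu>2, weighted by 1 - t, uses up only
    half of the deficit \<alpha> of \<nu>1, weighted by t. Maximality of h then supplies a code R on
    which \<nu>2 exceeds h by less than b.\<close>
  define b where "b = t * \<alpha> / (2 * (1 - t))"
  have b: "b > 0" "(1 - t) * b = t * \<alpha> / 2" using t \<alpha> by (auto simp: b_def field_simps)
  have "\<not> code_entropy_ge T e \<nu>2 (h + b)" using max[OF \<nu>12(2)] b by fastforce
  then obtain m R where R: "m > 0" "code T e m R" "\<And>x. R x > 0" "(\<integral>x. - ln (R x) \<partial>\<nu>2) < real m * (h + b)"
    unfolding code_entropy_ge_def by (auto simp: not_le)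
  have bp: "\<nu> \<in> borel_probs" "\<nu>1 \<in> borel_probs" "\<nu>2 \<in> borel_probs"
    using \<nu> \<nu>12 by (auto simp: invariant_probs_def)
  interpret \<nu>1: prob_space \<nu>1 using bp by (simp add: borel_probs_def)
  interpret \<nu>2: prob_space \<nu>2 using bp by (simp add: borel_probs_def)
  have bound: "real k * (real n * real m * (t * \<alpha> / 2)) \<le> ln 2" if "k > 0" for k
  proof -
    define P1 where "P1 x = (\<Prod>j<m * k. Q ((T ^^ (n * j)) x))" for x
    define P2 where "P2 x = (\<Prod>j<n * k. R ((T ^^ (m * j)) x))" for x
    define P where "P x = (\<Sum>i\<in>{False, True}. 1 / 2 * (if i then P1 else P2) x)" for x
    \<comment> \<open>A common multiple of both block lengths: m k copies of Q and n k copies of R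
      have equal length and can be mixed. The factor k is free and later outweighs ln 2.\<close>
    define N where "N = n * m * k"
    have N: "N > 0" using Q(1) R(1) that by (simp add: N_def)
    have P1: "code T e N P1" "\<And>x. P1 x > 0"
      using code_power[OF Q(2), of "m * k"] Q(3) by (auto simp: P1_def[abs_def] N_def mult.assoc intro!: prod_pos)
    have P2: "code T e N P2" "\<And>x. P2 x > 0"
      using code_power[OF R(2), of "n * k"] R(3) by (auto simp: P2_def[abs_def] N_def mult.assoc mult.left_commute intro!: prod_pos)
    have P: "code T e N P"
      unfolding P_def using P1(1) P2(1) by (intro code_mix) auto
    have P_eq: "P x = (P1 x + P2 x) / 2" for x by (simp add: P_def)
    have P_pos: "P x > 0" for x unfolding P_eq using P1(2)[of x] P2(2)[of x] by simp
    have half: "- ln (P x) \<le> ln 2 + - ln (P1 x)" "- ln (P x) \<le> ln 2 + - ln (P2 x)" for x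
    proof -
      have "ln (P1 x / 2) \<le> ln (P x)" "ln (P2 x / 2) \<le> ln (P x)"
        unfolding P_eq using P1(2)[of x] P2(2)[of x] by (auto intro!: ln_mono)
      then show "- ln (P x) \<le> ln 2 + - ln (P1 x)" "- ln (P x) \<le> ln 2 + - ln (P2 x)"
        using P1(2)[of x] P2(2)[of x] by (auto simp: ln_div)
    qed
    have int1: "integrable \<nu>1 (\<lambda>x. - ln (P1 x))" "integrable \<nu>1 (\<lambda>x. - ln (P x))"
      using integrable_neg_ln_code[OF bp(2)] P1 P P_pos by auto
    have int2: "integrable \<nu>2 (\<lambda>x. - ln (P2 x))" "integrable \<nu>2 (\<lambda>x. - ln (P x))"
      using integrable_neg_ln_code[OF bp(3)] P2 P P_pos by auto
    have "(\<integral>x. - ln (P x) \<partial>\<nu>1) \<le> (\<integral>x. ln 2 + - ln (P1 x) \<partial>\<nu>1)"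
      by (rule integral_mono[OF int1(2) Bochner_Integration.integrable_add[OF _ int1(1)] half(1)]) simp
    also have "\<dots> = ln 2 + (\<integral>x. - ln (P1 x) \<partial>\<nu>1)"
      by (subst Bochner_Integration.integral_add[OF _ int1(1)]) (simp_all add: \<nu>1.prob_space)
    also have "(\<integral>x. - ln (P1 x) \<partial>\<nu>1) = real (m * k) * a"
      unfolding P1_def a_def by (rule integral_neg_ln_power[OF \<nu>12(1) Q(2,3)])
    also have "\<dots> = real N * (h - \<alpha>)" by (simp add: N_def \<alpha>(2))
    finally have 1: "(\<integral>x. - ln (P x) \<partial>\<nu>1) \<le> ln 2 + real N * (h - \<alpha>)" .
    have "(\<integral>x. - ln (P x) \<partial>\<nu>2) \<le> (\<integral>x. ln 2 + - ln (P2 x) \<partial>\<nu>2)"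
      by (rule integral_mono[OF int2(2) Bochner_Integration.integrable_add[OF _ int2(1)] half(2)]) simp
    also have "\<dots> = ln 2 + (\<integral>x. - ln (P2 x) \<partial>\<nu>2)"
      by (subst Bochner_Integration.integral_add[OF _ int2(1)]) (simp_all add: \<nu>2.prob_space)
    also have "(\<integral>x. - ln (P2 x) \<partial>\<nu>2) = real (n * k) * (\<integral>x. - ln (R x) \<partial>\<nu>2)"
      unfolding P2_def by (rule integral_neg_ln_power[OF \<nu>12(2) R(2,3)])
    also have "\<dots> \<le> real (n * k) * (real m * (h + b))"
      using R(4) by (intro mult_left_mono) auto
    also have "\<dots> = real N * (h + b)" by (simp add: N_def)
    finally have 2: "(\<integral>x. - ln (P x) \<partial>\<nu>2) \<le> ln 2 + real N * (h + b)" by simp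
    have "real N * h \<le> (\<integral>x. - ln (P x) \<partial>\<nu>)"
      using \<nu>(2) P P_pos N unfolding code_entropy_ge_def by blast
    also have "\<dots> = t * (\<integral>x. - ln (P x) \<partial>\<nu>1) + (1 - t) * (\<integral>x. - ln (P x) \<partial>\<nu>2)"
      using P P_pos by (intro mix continuous_on_neg_ln continuous_on_code[OF _ continuous_T e_pos]) auto
    also have "\<dots> \<le> t * (ln 2 + real N * (h - \<alpha>)) + (1 - t) * (ln 2 + real N * (h + b))"
      using 1 2 t by (intro add_mono mult_left_mono) auto
    also have "\<dots> = ln 2 + real N * h - real N * (t * \<alpha>) + real N * ((1 - t) * b)"
      by (simp add: algebra_simps)
    finally show ?thesis unfolding b(2) by (simp add: N_def field_simps)
  qed
  have "0 < real n * real m * (t * \<alpha> / 2)" using Q(1) R(1) t \<alpha> by simp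
  then obtain k where k: "ln 2 < real k * (real n * real m * (t * \<alpha> / 2))"
    using reals_Archimedean3 by blast
  then have "k > 0" by (intro Nat.gr0I) auto
  then show False using bound[of k] k by simp
qed

section \<open>Weak continuity of the moment functional\<close>

lemma moment_bound:
  fixes f :: "'a \<Rightarrow> real"
  assumes "continuous_on UNIV f" "\<And>x. \<bar>f x\<bar> \<le> 1" "\<nu> \<in> borel_probs"
  shows "(\<integral>x. f x \<partial>\<nu>)\<^sup>2 \<le> 1"
proof -
  interpret prob_space \<nu> using assms by (simp add: borel_probs_def)
  have "\<bar>\<integral>x. f x \<partial>\<nu>\<bar> \<le> (\<integral>x. \<bar>f x\<bar> \<partial>\<nu>)" by (rule integral_abs_bound)
  also have "\<dots> \<le> (\<integral>x. 1 \<partial>\<nu>)"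
    using assms by (intro integral_mono integrable_abs integrable_continuous_borel_probs[OF compact_UNIV]) auto
  finally show ?thesis by (simp add: prob_space abs_square_le_1)
qed

lemma summable_half: "summable (\<lambda>k. (1 / 2 :: real) ^ k)"
  by (rule summable_geometric) simp

lemma summable_moments:
  fixes f :: "nat \<Rightarrow> 'a \<Rightarrow> real"
  assumes "\<And>k. continuous_on UNIV (f k)" "\<And>k x. \<bar>f k x\<bar> \<le> 1" "\<nu> \<in> borel_probs"
  shows "summable (\<lambda>k. (1 / 2) ^ k * (\<integral>x. f k x \<partial>\<nu>)\<^sup>2)"
  using moment_bound[OF assms]
  by (intro summable_comparison_test'[OF summable_half, of 0]) (simp add: mult_left_le)

lemma moment_energy_tendsto:
  fixes f :: "nat \<Rightarrow> 'a \<Rightarrow> real"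
  assumes f: "\<And>k. continuous_on UNIV (f k)" "\<And>k x. \<bar>f k x\<bar> \<le> 1"
    and \<nu>: "\<And>n. \<nu> n \<in> borel_probs" "weakly_converges \<nu> \<mu>"
  shows "(\<lambda>n. moment_energy f (\<nu> n)) \<longlonglongrightarrow> moment_energy f \<mu>"
proof -
  have b: "norm ((1 / 2) ^ k * (\<integral>x. f k x \<partial>\<nu> n)\<^sup>2) \<le> (1 / 2) ^ k" for k n
    using moment_bound[OF f \<nu>(1)] by (simp add: mult_left_le)
  have "eventually (\<lambda>(k, n). norm ((1 / 2) ^ k * (\<integral>x. f k x \<partial>\<nu> n)\<^sup>2) \<le> (1 / 2) ^ k)
      (at_top \<times>\<^sub>F sequentially)"
    using b by (intro always_eventually) simp
  moreover have "(\<lambda>n. (1 / 2) ^ k * (\<integral>x. f k x \<partial>\<nu> n)\<^sup>2) \<longlonglongrightarrow> (1 / 2) ^ k * (\<integral>x. f k x \<partial>\<mu>)\<^sup>2" for k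
    by (intro tendsto_intros weakly_convergesD[OF \<nu>(2) f(1)])
  ultimately show ?thesis
    unfolding moment_energy_def
    using tannerys_theorem[of "\<lambda>k n. (1 / 2) ^ k * (\<integral>x. f k x \<partial>\<nu> n)\<^sup>2" "\<lambda>k. (1 / 2) ^ k * (\<integral>x. f k x \<partial>\<mu>)\<^sup>2"
        sequentially "\<lambda>k. (1 / 2) ^ k"] summable_half by auto
qed

text \<open>Since A equals its preimage, the density \<open>indicator A x / p\<close> takes the same
  value at x and T x, so conditioning on A preserves invariance.\<close>

lemma conditional_invariant:
  assumes \<nu>: "\<nu> \<in> invariant_probs T" and A: "A \<in> sets borel" "T -` A = A" "measure \<nu> A > 0"
  obtains \<nu>A where "\<nu>A \<in> invariant_probs T"
    "\<And>f::'a \<Rightarrow> real. f \<in> borel_measurable borel \<Longrightarrow> (\<integral>x. f x \<partial>\<nu>A) = (\<integral>x. indicator A x * f x \<partial>\<nu>) / measure \<nu> A"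
proof -
  define p where "p = measure \<nu> A"
  have bp: "\<nu> \<in> borel_probs" using \<nu> by (simp add: invariant_probs_def)
  interpret prob_space \<nu> using bp by (simp add: borel_probs_def)
  have s: "sets \<nu> = sets borel" using bp by (simp add: borel_probs_def)
  have As: "A \<in> sets \<nu>" using A(1) s by simp
  define \<nu>A where "\<nu>A = density \<nu> (\<lambda>x. ennreal (indicator A x / p))"
  have p: "p > 0" using A(3) by (simp add: p_def)
  have g: "(\<lambda>x. indicator A x / p) \<in> borel_measurable \<nu>" using As by measurable
  have int: "(\<integral>x. f x \<partial>\<nu>A) = (\<integral>x. indicator A x * f x \<partial>\<nu>) / p"
    if "f \<in> borel_measurable borel" for f :: "'a \<Rightarrow> real"
  proof -
    have "f \<in> borel_measurable \<nu>" using that unfolding measurable_cong_sets[OF s refl] .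
    then have "(\<integral>x. f x \<partial>\<nu>A) = (\<integral>x. (indicator A x / p) * f x \<partial>\<nu>)"
      unfolding \<nu>A_def using g p by (intro integral_real_density) auto
    then show ?thesis by simp
  qed
  have "prob_space \<nu>A"
  proof (rule prob_spaceI)
    have "emeasure \<nu>A (space \<nu>A) = (\<integral>\<^sup>+x. ennreal (indicator A x / p) \<partial>\<nu>)"
      unfolding \<nu>A_def using g by (subst emeasure_density) (auto intro!: nn_integral_cong)
    also have "\<dots> = (\<integral>\<^sup>+x. ennreal (1 / p) * indicator A x \<partial>\<nu>)"
      by (intro nn_integral_cong) (simp split: split_indicator)
    also have "\<dots> = ennreal (1 / p) * emeasure \<nu> A" using As by (rule nn_integral_cmult_indicator)
    also have "\<dots> = 1" using p by (simp add: emeasure_eq_measure p_def[symmetric] ennreal_mult[symmetric])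
    finally show "emeasure \<nu>A (space \<nu>A) = 1" .
  qed
  then have "\<nu>A \<in> borel_probs" using s by (simp add: borel_probs_def \<nu>A_def)
  moreover have "(\<integral>x. f (T x) \<partial>\<nu>A) = (\<integral>x. f x \<partial>\<nu>A)" if f: "continuous_on UNIV f" for f :: "'a \<Rightarrow> real"
  proof -
    note fm = borel_measurable_continuous_onI[OF f] borel_measurable_continuous_onI[OF continuous_on_comp_T[OF f]]
    have "(\<integral>x. indicator A x * f (T x) \<partial>\<nu>) = (\<integral>x. indicator A ((T ^^ 1) x) * f ((T ^^ 1) x) \<partial>\<nu>)"
    proof (intro Bochner_Integration.integral_cong refl)
      fix x have "T x \<in> A \<longleftrightarrow> x \<in> A" using A(2) by blast
      then show "indicator A x * f (T x) = indicator A ((T ^^ 1) x) * f ((T ^^ 1) x)"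
        by (simp add: indicator_def)
    qed
    also have "\<dots> = (\<integral>x. indicator A x * f x \<partial>\<nu>)"
      by (intro invariant_integral_funpow[OF \<nu>] borel_measurable_times borel_measurable_indicator A(1) fm(1))
    finally show ?thesis by (simp add: int fm)
  qed
  ultimately have "\<nu>A \<in> invariant_probs T" by (rule invariant_probsI)
  then show ?thesis using that int unfolding p_def by blast
qed

text \<open>The entropy is maximised first because the face property is derived from maximality. If
  the maximiser \<mu> of \<Phi> on the face had an invariant set of measure t strictly between 0 and
  1, the conditional measures on the set and its complement would lie in the face, and strict
  convexity would force them to coincide; but they give that set mass 1 and 0.\<close>

lemma exists_ergodic_code_entropy_ge:
  assumes "\<nu>0 \<in> invariant_probs T" "code_entropy_ge T e \<nu>0 h0"
  obtains \<mu> where "\<mu> \<in> ergodic_measures T" "code_entropy_ge T e \<mu> h0"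
proof -
  obtain h \<nu>1 where h: "h0 \<le> h" "\<nu>1 \<in> invariant_probs T" "code_entropy_ge T e \<nu>1 h"
    "\<And>\<xi> g. \<xi> \<in> invariant_probs T \<Longrightarrow> code_entropy_ge T e \<xi> g \<Longrightarrow> g \<le> h"
    using max_code_entropy[OF assms] by metis
  define M where "M = {\<nu> \<in> invariant_probs T. code_entropy_ge T e \<nu> h}"
  have M_bp: "\<nu> \<in> borel_probs" if "\<nu> \<in> M" for \<nu> using that by (simp add: M_def invariant_probs_def)
  obtain f :: "nat \<Rightarrow> 'a \<Rightarrow> real" where f: "\<And>k. continuous_on UNIV (f k)" "\<And>k x. \<bar>f k x\<bar> \<le> 1"
    "\<And>\<mu> \<nu>. \<mu> \<in> borel_probs \<Longrightarrow> \<nu> \<in> borel_probs \<Longrightarrow>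
      (\<And>k. (\<integral>x. f k x \<partial>\<mu>) = (\<integral>x. f k x \<partial>\<nu>)) \<Longrightarrow> \<mu> = \<nu>"
    using separating_sequence[OF compact_UNIV] by blast
  define \<Phi> where "\<Phi> = moment_energy f"
  have "\<Phi> \<nu> \<le> (\<Sum>k. (1 / 2) ^ k)" if "\<nu> \<in> M" for \<nu>
    unfolding \<Phi>_def moment_energy_def
    using moment_bound[OF f(1,2) M_bp[OF that]] summable_moments[OF f(1,2) M_bp[OF that]] summable_half
    by (intro suminf_le) (auto simp: mult_left_le)
  then have bdd: "bdd_above (\<Phi> ` M)" by (auto intro!: bdd_aboveI2)
  have ne: "\<Phi> ` M \<noteq> {}" using h(2,3) by (auto simp: M_def)
  have "\<exists>\<nu>\<in>M. Sup (\<Phi> ` M) - 1 / Suc k < \<Phi> \<nu>" for k :: nat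
  proof -
    have "Sup (\<Phi> ` M) - 1 / Suc k < Sup (\<Phi> ` M)" by simp
    then show ?thesis using less_cSup_iff[OF ne bdd] by blast
  qed
  then obtain \<nu> where \<nu>: "\<And>k. \<nu> k \<in> M" "\<And>k. Sup (\<Phi> ` M) - 1 / Suc k < \<Phi> (\<nu> k)" by metis
  have \<nu>_inv: "\<nu> k \<in> invariant_probs T" "code_entropy_ge T e (\<nu> k) h" for k
    using \<nu>(1)[of k] by (auto simp: M_def)
  obtain r \<mu> where r: "strict_mono r" "\<mu> \<in> invariant_probs T" "weakly_converges (\<nu> \<circ> r) \<mu>"
    "code_entropy_ge T e \<mu> h"
    by (rule invariant_code_entropy_limit[OF \<nu>_inv tendsto_const])
  have bp: "\<mu> \<in> borel_probs" using r(2) by (simp add: invariant_probs_def)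
  interpret prob_space \<mu> using bp by (simp add: borel_probs_def)
  have s: "sets \<mu> = sets borel" using bp by (simp add: borel_probs_def)
  have lim: "(\<lambda>k. \<Phi> ((\<nu> \<circ> r) k)) \<longlonglongrightarrow> \<Phi> \<mu>"
    unfolding \<Phi>_def by (rule moment_energy_tendsto[OF f(1,2) _ r(3)]) (simp add: M_bp[OF \<nu>(1)])
  have "(\<lambda>k. Sup (\<Phi> ` M) - 1 / real (Suc k)) \<longlonglongrightarrow> Sup (\<Phi> ` M)"
    using tendsto_diff[OF tendsto_const[of "Sup (\<Phi> ` M)"] LIMSEQ_inverse_real_of_nat]
    by (simp add: inverse_eq_divide)
  from LIMSEQ_subseq_LIMSEQ[OF this r(1)]
  have lim': "(\<lambda>k. Sup (\<Phi> ` M) - 1 / real (Suc (r k))) \<longlonglongrightarrow> Sup (\<Phi> ` M)" unfolding o_def .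
  have "Sup (\<Phi> ` M) \<le> \<Phi> \<mu>"
    using less_imp_le[OF \<nu>(2)] unfolding o_def
    by (intro LIMSEQ_le[OF lim' lim] exI[of _ 0] allI impI) (simp only: o_def)
  then have max: "\<Phi> \<xi> \<le> \<Phi> \<mu>" if "\<xi> \<in> M" for \<xi>
    using cSup_upper[OF imageI[OF that] bdd] by linarith
  have "measure \<mu> A = 0 \<or> measure \<mu> A = 1" if A: "A \<in> sets borel" "T -` A = A" for A
  proof (rule ccontr)
    assume na: "\<not> ?thesis"
    define t where "t = measure \<mu> A"
    have t: "0 < t" "t < 1" using na prob_le_1[of A] measure_nonneg[of \<mu> A] by (auto simp: t_def less_le)
    have As: "A \<in> sets \<mu>" using A(1) s by simp
    have B: "- A \<in> sets borel" "T -` (- A) = - A" using A by (auto simp: vimage_Compl)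
    have tB: "measure \<mu> (- A) = 1 - t"
      using prob_compl[OF As] borel_probs_space[OF bp] by (simp add: t_def Compl_eq_Diff_UNIV)
    obtain \<mu>1 where 1: "\<mu>1 \<in> invariant_probs T"
      "\<And>f::'a \<Rightarrow> real. f \<in> borel_measurable borel \<Longrightarrow> (\<integral>x. f x \<partial>\<mu>1) = (\<integral>x. indicator A x * f x \<partial>\<mu>) / t"
      using conditional_invariant[OF r(2) A] t unfolding t_def by blast
    obtain \<mu>2 where 2: "\<mu>2 \<in> invariant_probs T"
      "\<And>f::'a \<Rightarrow> real. f \<in> borel_measurable borel \<Longrightarrow> (\<integral>x. f x \<partial>\<mu>2) = (\<integral>x. indicator (- A) x * f x \<partial>\<mu>) / (1 - t)"
      using conditional_invariant[OF r(2) B] t unfolding tB by auto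
    have mix: "(\<integral>x. g x \<partial>\<mu>) = t * (\<integral>x. g x \<partial>\<mu>1) + (1 - t) * (\<integral>x. g x \<partial>\<mu>2)"
      if g: "continuous_on UNIV g" for g :: "'a \<Rightarrow> real"
    proof -
      note gm = borel_measurable_continuous_onI[OF g]
      have gi: "integrable \<mu> g" by (rule integrable_continuous_borel_probs[OF compact_UNIV bp g])
      have i: "integrable \<mu> (\<lambda>x. indicator A x * g x)" "integrable \<mu> (\<lambda>x. indicator (- A) x * g x)"
        using integrable_real_mult_indicator[OF As gi] integrable_real_mult_indicator[OF _ gi, of "- A"] B(1) s
        by (auto simp: mult.commute)
      have "(\<integral>x. g x \<partial>\<mu>) = (\<integral>x. indicator A x * g x + indicator (- A) x * g x \<partial>\<mu>)"
        by (intro Bochner_Integration.integral_cong refl) (simp split: split_indicator)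
      also have "\<dots> = (\<integral>x. indicator A x * g x \<partial>\<mu>) + (\<integral>x. indicator (- A) x * g x \<partial>\<mu>)"
        by (rule Bochner_Integration.integral_add[OF i])
      finally show ?thesis using t by (simp add: 1(2) 2(2) gm)
    qed
    \<comment> \<open>\<open>code_entropy_face\<close> speaks of the first component, so the roles
      are exchanged for the second one.\<close>
    have mix': "(\<integral>x. g x \<partial>\<mu>) = (1 - t) * (\<integral>x. g x \<partial>\<mu>2) + (1 - (1 - t)) * (\<integral>x. g x \<partial>\<mu>1)"
      if g: "continuous_on UNIV g" for g :: "'a \<Rightarrow> real" using mix[OF g] by simp
    have "code_entropy_ge T e \<mu>1 h"
      by (rule code_entropy_face[where t = t, OF r(2,4) h(4) 1(1) 2(1) t mix])
    moreover have "code_entropy_ge T e \<mu>2 h"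
      by (rule code_entropy_face[where t = "1 - t", OF r(2,4) h(4) 2(1) 1(1) _ _ mix']) (use t in auto)
    ultimately have M12: "\<mu>1 \<in> M" "\<mu>2 \<in> M" using 1(1) 2(1) by (auto simp: M_def)
    define a where "a k = (\<integral>x. f k x \<partial>\<mu>1)" for k
    define b where "b k = (\<integral>x. f k x \<partial>\<mu>2)" for k
    define w where "w k = (1 / 2 :: real) ^ k" for k :: nat
    have S1: "summable (\<lambda>k. w k * (a k)\<^sup>2)" unfolding a_def w_def by (rule summable_moments[OF f(1,2) M_bp[OF M12(1)]])
    have S2: "summable (\<lambda>k. w k * (b k)\<^sup>2)" unfolding b_def w_def by (rule summable_moments[OF f(1,2) M_bp[OF M12(2)]])
    have S0: "summable (\<lambda>k. w k * (t * a k + (1 - t) * b k)\<^sup>2)"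
      using summable_moments[OF f(1,2) bp] unfolding mix[OF f(1)] a_def b_def w_def .
    \<comment> \<open>The variance of a two-point distribution: it measures how far the convexity
      inequality is from equality.\<close>
    have convex: "t * (1 - t) * (w k * (a k - b k)\<^sup>2) =
        t * (w k * (a k)\<^sup>2) + (1 - t) * (w k * (b k)\<^sup>2) - w k * (t * a k + (1 - t) * b k)\<^sup>2" for k
      by (simp add: power2_eq_square algebra_simps)
    have Sd: "summable (\<lambda>k. t * (1 - t) * (w k * (a k - b k)\<^sup>2))"
      unfolding convex by (intro summable_diff summable_add summable_mult S0 S1 S2)
    have "(\<Sum>k. t * (1 - t) * (w k * (a k - b k)\<^sup>2)) =
        t * (\<Sum>k. w k * (a k)\<^sup>2) + (1 - t) * (\<Sum>k. w k * (b k)\<^sup>2) - (\<Sum>k. w k * (t * a k + (1 - t) * b k)\<^sup>2)"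
      unfolding convex
      by (simp add: suminf_diff[symmetric] suminf_add[symmetric] suminf_mult[symmetric] summable_add summable_mult S0 S1 S2)
    also have "\<dots> = t * \<Phi> \<mu>1 + (1 - t) * \<Phi> \<mu>2 - \<Phi> \<mu>"
      unfolding \<Phi>_def moment_energy_def mix[OF f(1)] a_def b_def w_def ..
    also have "\<dots> \<le> t * \<Phi> \<mu> + (1 - t) * \<Phi> \<mu> - \<Phi> \<mu>"
      using max M12 t by (intro diff_right_mono add_mono mult_left_mono) auto
    also have "\<dots> = 0" by (simp add: algebra_simps)
    finally have "(\<Sum>k. t * (1 - t) * (w k * (a k - b k)\<^sup>2)) = 0"
      using t by (intro antisym suminf_nonneg Sd) (auto simp: w_def)
    then have "t * (1 - t) * (w k * (a k - b k)\<^sup>2) = 0" for k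
      using t by (subst (asm) suminf_eq_zero_iff[OF Sd]) (auto simp: w_def)
    then have "a k = b k" for k using t by (auto simp: w_def)
    then have "\<mu>1 = \<mu>2" using f(3)[OF M_bp[OF M12(1)] M_bp[OF M12(2)]] by (simp add: a_def b_def)
    moreover have "(\<integral>x. indicator A x \<partial>\<mu>1) = (1::real)"
    proof -
      have "(\<lambda>x. indicator A x * indicator A x :: real) = indicator A" by (auto simp: indicator_def)
      then show ?thesis using t A(1) As borel_probs_space[OF bp] by (subst 1(2)) (simp_all add: t_def)
    qed
    moreover have "(\<integral>x. indicator A x \<partial>\<mu>2) = (0::real)"
    proof -
      have "(\<lambda>x. indicator (- A) x * indicator A x :: real) = (\<lambda>_. 0)" by (auto simp: indicator_def)
      then show ?thesis using A(1) by (subst 2(2)) simp_all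
    qed
    ultimately show False by simp
  qed
  then have "\<mu> \<in> ergodic_measures T"
    using r(2) s prob_space_axioms by (simp add: ergodic_measures_def invariant_probs_def)
  then show ?thesis using that code_entropy_ge_mono[OF r(4) h(1)] by blast
qed

end

subsection \<open>Comparison of scales\<close>

lemma bowen_dist_commute: "bowen_dist T n x y = bowen_dist T n y x"
  by (simp add: bowen_dist_def dist_commute)

context compact_system begin

lemma sep_growth_le_SUP_katok:
  assumes "0 < \<delta>" "\<delta> < 1"
  shows "sep_growth T UNIV (4 * e) \<le> (SUP \<mu>\<in>ergodic_measures T. katok_entropy T \<mu> e \<delta>)"
proof (rule ccontr)
  assume "\<not> ?thesis"
  then obtain h where h: "(SUP \<mu>\<in>ergodic_measures T. katok_entropy T \<mu> e \<delta>) < ereal h" "ereal h < sep_growth T UNIV (4 * e)"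
    by (metis ereal_dense2 not_le)
  obtain \<nu> where "\<nu> \<in> invariant_probs T" "code_entropy_ge T e \<nu> h"
    by (rule exists_invariant_code_entropy_ge[OF h(2)])
  then obtain \<mu> where \<mu>: "\<mu> \<in> ergodic_measures T" "code_entropy_ge T e \<mu> h"
    by (rule exists_ergodic_code_entropy_ge)
  have "ereal h \<le> katok_entropy T \<mu> e \<delta>" by (rule code_entropy_le_katok[OF \<mu> assms])
  also have "\<dots> \<le> (SUP \<mu>\<in>ergodic_measures T. katok_entropy T \<mu> e \<delta>)" using \<mu>(1) by (rule SUP_upper)
  finally show False using h(1) by simp
qed

text \<open>A point at distance more than 4 e from a separated set of maximal cardinality could be
  added to it. Hence every point is within 4 e of the set, and the open balls of radius 8 e cover
  the space.\<close>

lemma katok_number_le_sep_number: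
  assumes "prob_space \<mu>" "sets \<mu> = sets borel" "\<delta> < 1" "n > 0"
  shows "katok_number T \<mu> \<delta> n (8 * e) \<le> sep_number T UNIV n (4 * e)"
proof -
  obtain E where E: "finite E" "E \<noteq> {}" "dyn_separated T n (4 * e) E" "card E = sep_number T UNIV n (4 * e)"
    by (rule max_separated_set[OF \<open>n > 0\<close>])
  have "\<exists>x\<in>E. bowen_dist T n x y \<le> 4 * e" for y
  proof (rule ccontr)
    assume *: "\<not> ?thesis"
    have "bowen_dist T n y y \<le> 4 * e" using \<open>n > 0\<close> e_pos by (simp add: bowen_dist_le_iff)
    then have "y \<notin> E" using * by blast
    have "bowen_dist T n x y > 4 * e" "bowen_dist T n y x > 4 * e" if "x \<in> E" for x
      using * that unfolding bowen_dist_commute[of T n y x] by (auto simp: not_le)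
    then have "dyn_separated T n (4 * e) (insert y E)"
      using E(3) by (auto simp: dyn_separated_def)
    then have "card (insert y E) \<in> {card E |E. E \<subseteq> (UNIV::'a set) \<and> finite E \<and> dyn_separated T n (4 * e) E}"
      using E(1) by blast
    then have "card (insert y E) \<le> sep_number T UNIV n (4 * e)"
      unfolding sep_number_def using e_pos
      by (intro Max_ge finite_dyn_separated_cards[OF compact_UNIV continuous_T \<open>n > 0\<close>]) simp_all
    then show False using E(1,4) \<open>y \<notin> E\<close> by simp
  qed
  moreover have "4 * e < 8 * e" using e_pos by simp
  ultimately have "\<exists>x\<in>E. y \<in> dyn_ball T n x (8 * e)" for y
    unfolding dyn_ball_def mem_Collect_eq using le_less_trans by blast
  then have "(\<Union>x\<in>E. dyn_ball T n x (8 * e)) = UNIV" by blast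
  moreover have "measure \<mu> UNIV = 1"
    using prob_space.prob_space[OF assms(1)] sets_eq_imp_space_eq[OF assms(2)] by simp
  ultimately have "finite E \<and> card E = card E \<and> measure \<mu> (\<Union>x\<in>E. dyn_ball T n x (8 * e)) > \<delta>"
    using E(1) assms(3) by simp
  then show ?thesis unfolding katok_number_def E(4)[symmetric] by (intro Least_le exI)
qed

lemma katok_entropy_le_sep_growth:
  assumes "\<mu> \<in> ergodic_measures T" "0 < \<delta>" "\<delta> < 1"
  shows "katok_entropy T \<mu> (8 * e) \<delta> \<le> sep_growth T UNIV (4 * e)"
  unfolding katok_entropy_def sep_growth_def
proof (rule Limsup_mono, rule eventually_mono[OF eventually_gt_at_top[of 0]])
  fix n :: nat assume n: "0 < n"
  have \<mu>: "prob_space \<mu>" "sets \<mu> = sets borel" using assms(1) by (auto simp: ergodic_measures_def)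
  obtain C where "finite C" "card C = katok_number T \<mu> \<delta> n (8 * e)" "measure \<mu> (\<Union>x\<in>C. dyn_ball T n x (8 * e)) > \<delta>"
    using katok_number_attained[OF compact_UNIV continuous_T n _ \<mu> assms(3), of "8 * e"] e_pos by auto
  then have "katok_number T \<mu> \<delta> n (8 * e) > 0" using assms(2) by (intro Nat.gr0I) auto
  then have "ln (real (katok_number T \<mu> \<delta> n (8 * e))) \<le> ln (real (sep_number T UNIV n (4 * e)))"
    using katok_number_le_sep_number[OF \<mu> assms(3) n] by (intro ln_mono) auto
  then show "ereal (1 / real n * ln (real (katok_number T \<mu> \<delta> n (8 * e)))) \<le> ereal (1 / real n * ln (real (sep_number T UNIV n (4 * e))))"
    by (simp add: divide_right_mono)
qed

lemma sep_growth_nonneg: "0 \<le> sep_growth T UNIV (4 * e)"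
proof -
  have "0 \<le> limsup (\<lambda>n. ereal (1 / real n * ln (real (sep_number T UNIV n (4 * e)))))"
  proof (rule le_Limsup[OF trivial_limit_sequentially])
    show "\<forall>\<^sub>F n in sequentially. 0 \<le> ereal (1 / real n * ln (real (sep_number T UNIV n (4 * e))))"
    proof (rule eventually_mono[OF eventually_gt_at_top[of 0]])
      fix n :: nat assume "0 < n"
      then obtain E where "finite E" "E \<noteq> {}" "dyn_separated T n (4 * e) E" "card E = sep_number T UNIV n (4 * e)"
        by (rule max_separated_set)
      then have "1 \<le> real (sep_number T UNIV n (4 * e))"
        by (metis One_nat_def Suc_leI card_gt_0_iff of_nat_1 of_nat_mono)
      then show "0 \<le> ereal (1 / real n * ln (real (sep_number T UNIV n (4 * e))))" by simp
    qed
  qed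
  then show ?thesis by (simp add: sep_growth_def)
qed

end

text \<open>\<Lambda> stands for the limit superior or the limit inferior at 0 from the right, of
  which only monotonicity, homogeneity and invariance under rescaling enter. The logarithms at
  \<epsilon>, 4 \<epsilon> and \<epsilon>/2 differ by constants, so a factor t < 1 absorbs the
  change for small \<epsilon>; then t tends to 1.\<close>

lemma log_growth_rate_rescaling:
  fixes S H :: "real \<Rightarrow> ereal" and \<Lambda> :: "(real \<Rightarrow> ereal) \<Rightarrow> ereal"
  assumes lower: "\<And>\<epsilon>. \<epsilon> > 0 \<Longrightarrow> S (4 * \<epsilon>) \<le> H \<epsilon>" and upper: "\<And>\<epsilon>. \<epsilon> > 0 \<Longrightarrow> H \<epsilon> \<le> S (\<epsilon> / 2)"
    and nonneg: "\<And>\<epsilon>. \<epsilon> > 0 \<Longrightarrow> 0 \<le> S \<epsilon>"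
    and mono: "\<And>f g. (\<forall>\<^sub>F \<epsilon> in at_right 0. f \<epsilon> \<le> g \<epsilon>) \<Longrightarrow> \<Lambda> f \<le> \<Lambda> g"
    and scale: "\<And>c f. c \<ge> 0 \<Longrightarrow> \<Lambda> (\<lambda>\<epsilon>. ereal c * f \<epsilon>) = ereal c * \<Lambda> f"
    and rescale: "\<And>c f. c > 0 \<Longrightarrow> \<Lambda> (\<lambda>\<epsilon>. f (c * \<epsilon>)) = \<Lambda> f"
  shows "\<Lambda> (\<lambda>\<epsilon>. S \<epsilon> / ereal (ln (1 / \<epsilon>))) = \<Lambda> (\<lambda>\<epsilon>. ereal (1 / ln (1 / \<epsilon>)) * H \<epsilon>)"
proof -
  define F where "F \<epsilon> = S \<epsilon> / ereal (ln (1 / \<epsilon>))" for \<epsilon>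
  define G where "G \<epsilon> = ereal (1 / ln (1 / \<epsilon>)) * H \<epsilon>" for \<epsilon>
  \<comment> \<open>At \<epsilon> = 1 the two forms differ, as the inverse of 0 is infinite in
    \<open>ereal\<close> and 0 in \<open>real\<close>; for \<epsilon> < 1 the logarithm is
    positive.\<close>
  have F: "F \<epsilon> = ereal (1 / ln (1 / \<epsilon>)) * S \<epsilon>" if "0 < \<epsilon>" "\<epsilon> < 1" for \<epsilon>
    using that by (simp add: F_def divide_ereal_def mult.commute inverse_eq_divide)
  have small: "\<forall>\<^sub>F \<epsilon> in at_right 0. 0 < \<epsilon> \<and> \<epsilon> < a" if "a > 0" for a :: real
    using eventually_at_right_less eventually_at_right[of 0 a] that by (auto simp: eventually_at_right intro: exI[of _ a])
  have GF: "\<forall>\<^sub>F \<epsilon> in at_right 0. ereal t * F (4 * \<epsilon>) \<le> G \<epsilon> \<and> ereal t * G \<epsilon> \<le> F ((1 / 2) * \<epsilon>)"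
    if t: "0 < t" "t < 1" for t
  proof -
    \<comment> \<open>The bound 1/4 makes the logarithm at 4 \<epsilon> positive. The exponential
      gives \<open>(1 - t) * l > ln 4\<close>, which suffices for both inequalities because
      \<open>t * ln 2\<close> is at most ln 4.\<close>
    define a where "a = min (1 / 4) (exp (- (ln 4 / (1 - t))))"
    have "a > 0" by (simp add: a_def)
    from small[OF this] show ?thesis
    proof eventually_elim
      case (elim \<epsilon>)
      define l where "l = ln (1 / \<epsilon>)"
      have "ln \<epsilon> < ln (exp (- (ln 4 / (1 - t))))" using elim by (subst ln_less_cancel_iff) (auto simp: a_def)
      then have l: "(1 - t) * l > ln 4" using elim t by (simp add: l_def ln_div field_simps)
      have l0: "l > 0" using elim by (simp add: l_def a_def)
      have l4: "ln (1 / (4 * \<epsilon>)) = l - ln 4"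
        using elim by (simp add: l_def ln_div ln_mult)
      have "1 < 1 / (4 * \<epsilon>)" using elim by (simp add: a_def field_simps)
      then have l4_pos: "ln (1 / (4 * \<epsilon>)) > 0" by (rule ln_gt_zero)
      have l2: "ln (1 / ((1 / 2) * \<epsilon>)) = l + ln 2" using elim by (simp add: l_def ln_div ln_mult)
      have "t / ln (1 / (4 * \<epsilon>)) \<le> 1 / l"
        using l4 l4_pos l0 l by (simp add: field_simps)
      then have "ereal (t / ln (1 / (4 * \<epsilon>))) * S (4 * \<epsilon>) \<le> ereal (1 / l) * H \<epsilon>"
        using lower[of \<epsilon>] nonneg[of "4 * \<epsilon>"] elim l0 l4_pos t by (intro ereal_mult_mono) auto
      moreover have "ereal t * F (4 * \<epsilon>) = ereal (t / ln (1 / (4 * \<epsilon>))) * S (4 * \<epsilon>)"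
        using elim F[of "4 * \<epsilon>"] by (simp add: a_def mult.assoc[symmetric])
      moreover have tl: "t / l \<le> 1 / ln (1 / ((1 / 2) * \<epsilon>))"
      proof -
        have "t * ln 2 \<le> ln 2" using t by (simp add: mult_le_cancel_right1)
        also have "ln 2 \<le> ln (4 :: real)" by simp
        finally have "t * (l + ln 2) \<le> l" using l by (simp add: algebra_simps)
        then show ?thesis unfolding l2 using l0 by (simp add: divide_le_eq pos_le_divide_eq add_pos_pos mult.commute)
      qed
      moreover have "0 < ln (1 / ((1 / 2) * \<epsilon>))" unfolding l2 using l0 by (simp add: add_pos_pos)
      then have "ereal (t / l) * H \<epsilon> \<le> ereal (1 / ln (1 / ((1 / 2) * \<epsilon>))) * S (\<epsilon> / 2)"
        using tl upper[of \<epsilon>] order_trans[OF nonneg lower, of "\<epsilon>"] elim l0 t by (intro ereal_mult_mono) auto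
      moreover have "ereal t * G \<epsilon> = ereal (t / l) * H \<epsilon>"
        by (simp add: G_def l_def mult.assoc[symmetric])
      moreover have "F ((1 / 2) * \<epsilon>) = ereal (1 / ln (1 / ((1 / 2) * \<epsilon>))) * S (\<epsilon> / 2)"
        using elim F[of "(1 / 2) * \<epsilon>"] by (simp add: a_def)
      ultimately show ?case by (simp add: G_def l_def)
    qed
  qed
  have tFG: "ereal t * \<Lambda> F \<le> \<Lambda> G" "ereal t * \<Lambda> G \<le> \<Lambda> F" if t: "0 < t" "t < 1" for t
  proof -
    have "\<Lambda> (\<lambda>\<epsilon>. ereal t * F (4 * \<epsilon>)) \<le> \<Lambda> G" by (rule mono[OF eventually_mono[OF GF[OF t]]]) blast
    then show "ereal t * \<Lambda> F \<le> \<Lambda> G" using t by (simp add: scale rescale)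
    have "\<Lambda> (\<lambda>\<epsilon>. ereal t * G \<epsilon>) \<le> \<Lambda> (\<lambda>\<epsilon>. F ((1 / 2) * \<epsilon>))" by (rule mono[OF eventually_mono[OF GF[OF t]]]) blast
    then show "ereal t * \<Lambda> G \<le> \<Lambda> F" using t rescale[of "1 / 2" F] by (simp add: scale)
  qed
  have zero: "\<Lambda> (\<lambda>_. 0) = 0" using scale[of 0 "\<lambda>_. 0"] by (simp flip: zero_ereal_def)
  have "\<forall>\<^sub>F \<epsilon> in at_right 0. 0 \<le> F \<epsilon>"
    using small[of 1] by (auto elim!: eventually_mono simp: F nonneg)
  then have F0: "0 \<le> \<Lambda> F" using mono[of "\<lambda>_. 0" F] zero by simp
  have "0 \<le> \<Lambda> G" using tFG(1)[of "1/2"] F0 by (auto intro: order_trans[rotated])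
  \<comment> \<open>Passage to t = 1, valid for infinite values as well.\<close>
  have le: "x \<le> y" if "\<And>t. 0 < t \<Longrightarrow> t < 1 \<Longrightarrow> ereal t * x \<le> y" "0 \<le> y" for x y
  proof (rule ereal_le_mult_one_interval)
    fix z :: ereal assume "0 < z" "z < 1"
    then show "z * x \<le> y" using that(1) by (cases z) auto
  qed (use that(2) in auto)
  have "\<Lambda> F = \<Lambda> G"
    by (rule antisym[OF le[OF tFG(1) \<open>0 \<le> \<Lambda> G\<close>] le[OF tFG(2) F0]])
  then show ?thesis unfolding F_def G_def .
qed

theorem theorem4p2:
  fixes T :: "'a::metric_space \<Rightarrow> 'a" and \<delta> :: real
  assumes "compact (UNIV :: 'a set)"
    and "\<exists>S. homeomorphism UNIV UNIV T S"
    and "0 < \<delta>" and "\<delta> < 1"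
  shows "upper_mdim T =
           Limsup (at_right 0) (\<lambda>\<epsilon>. ereal (1 / ln (1 / \<epsilon>)) *
             (SUP \<mu>\<in>ergodic_measures T. katok_entropy T \<mu> \<epsilon> \<delta>)) \<and>
         lower_mdim T =
           Liminf (at_right 0) (\<lambda>\<epsilon>. ereal (1 / ln (1 / \<epsilon>)) *
             (SUP \<mu>\<in>ergodic_measures T. katok_entropy T \<mu> \<epsilon> \<delta>))"
proof -
  have cs: "compact_system T e" if "e > 0" for e
    using assms(1,2) that by (auto simp: compact_system_def homeomorphism_def)
  define S where "S \<epsilon> = sep_growth T UNIV \<epsilon>" for \<epsilon>
  define H where "H \<epsilon> = (SUP \<mu>\<in>ergodic_measures T. katok_entropy T \<mu> \<epsilon> \<delta>)" for \<epsilon>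
  have lower: "S (4 * \<epsilon>) \<le> H \<epsilon>" if "\<epsilon> > 0" for \<epsilon>
    unfolding S_def H_def using assms by (intro compact_system.sep_growth_le_SUP_katok cs that)
  have upper: "H \<epsilon> \<le> S (\<epsilon> / 2)" if "\<epsilon> > 0" for \<epsilon>
    unfolding S_def H_def
    \<comment> \<open>With e = \<epsilon>/8 the two scales 8 e and 4 e become \<epsilon> and
      \<epsilon>/2.\<close>
    using compact_system.katok_entropy_le_sep_growth[OF cs[of "\<epsilon> / 8"]] assms that
    by (intro SUP_least) simp
  have nonneg: "0 \<le> S \<epsilon>" if "\<epsilon> > 0" for \<epsilon>
    unfolding S_def using compact_system.sep_growth_nonneg[OF cs[of "\<epsilon> / 4"]] that by simp
  have filter: "filtermap (times c) (at_right 0) = at_right 0" if "c > 0" for c :: real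
    using filtermap_times_pos_at_right[OF that, of 0] by simp
  have inj: "inj (times c)" if "c > 0" for c :: real using that by (simp add: inj_on_def)
  have "Limsup (at_right 0) (\<lambda>\<epsilon>. S \<epsilon> / ereal (ln (1 / \<epsilon>))) =
      Limsup (at_right 0) (\<lambda>\<epsilon>. ereal (1 / ln (1 / \<epsilon>)) * H \<epsilon>)"
  proof (rule log_growth_rate_rescaling[OF lower upper nonneg])
    show "Limsup (at_right 0) (\<lambda>\<epsilon>. f (c * \<epsilon>)) = Limsup (at_right 0) f" if "c > 0" for c :: real and f :: "real \<Rightarrow> ereal"
      using Limsup_filtermap_eq[OF inj[OF that], of "at_right 0" f] filter[OF that] by simp
  qed (simp_all add: Limsup_mono Limsup_ereal_mult_left)
  moreover have "Liminf (at_right 0) (\<lambda>\<epsilon>. S \<epsilon> / ereal (ln (1 / \<epsilon>))) =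
      Liminf (at_right 0) (\<lambda>\<epsilon>. ereal (1 / ln (1 / \<epsilon>)) * H \<epsilon>)"
  proof (rule log_growth_rate_rescaling[OF lower upper nonneg])
    show "Liminf (at_right 0) (\<lambda>\<epsilon>. f (c * \<epsilon>)) = Liminf (at_right 0) f" if "c > 0" for c :: real and f :: "real \<Rightarrow> ereal"
      using Liminf_filtermap_eq[OF inj[OF that], of "at_right 0" f] filter[OF that] by simp
  qed (simp_all add: Liminf_mono Liminf_ereal_mult_left)
  ultimately show ?thesis unfolding upper_mdim_def lower_mdim_def S_def H_def by simp
qed

end
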